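(* Let $\pi: P \rightarrow M$ be a smooth principal $G$-bundle over a smooth manifold $M$, with $G$ any (finite dimensional) Lie group. Let $\sigma: \Gamma_{c}(TM) \rightarrow \Gamma_{c}(TP)^{G}$ be a Lie algebra homomorphism splitting the exact sequence of Lie algebras $$0 \rightarrow \Gamma_{c}(TP)^{G}_{v} \rightarrow \Gamma_{c}(TP)^{G} \xrightarrow{\ \pi_*\ } \Gamma_{c}(TM) \rightarrow 0 \,,$$ i.e. $\pi_*\circ\sigma=\mathrm{id}$. Then $\sigma$ is local in the sense that $\pi (\mathrm{Supp}(\sigma(v))) \subseteq \mathrm{Supp}(v)$ for all $v\in\Gamma_c(TM)$.
   Context: $\Gamma_{c}(TM)$ is the Lie algebra of smooth compactly supported vector fields on $M$. $\Gamma_{c}(TP)^{G}$ is the Lie algebra of $G$-invariant smooth vector fields $w$ on $P$ such that $\pi(\mathrm{Supp}(w))$ is compact; $\pi_*$ is the pushforward, and its kernel $\Gamma_{c}(TP)^{G}_{v}$ is the ideal of vertical vector fields. The homomorphism $\sigma$ is only assumed to be a homomorphism of real Lie algebras: no continuity or $C^\infty(M)$-linearity is required. *)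

theory Defs
  imports "HOL-Analysis.Analysis"
begin

section \<open>Model spaces\<close>

text \<open>
  Charts take values in a finite-dimensional real inner product space. The class
  \<open>euclidean_space\<close> would exclude dimension zero, and with it discrete structure groups.
\<close>

class fin_dim_inner = real_inner +
  assumes finitely_spanned: "\<exists>B. finite B \<and> (\<forall>x. \<exists>c. x = (\<Sum>b\<in>B. c b *\<^sub>R b))"

lemma finite_span: "\<exists>B :: 'a::fin_dim_inner set. finite B \<and> span B = UNIV"
proof -
  obtain B :: "'a set" where B: "finite B" "\<And>x. \<exists>c. x = (\<Sum>b\<in>B. c b *\<^sub>R b)"
    using finitely_spanned by blast
  have "x \<in> span B" for x
    using B(2)[of x] by (auto intro: span_sum span_scale span_base)
  then show ?thesis using B(1) by auto
qed

lemma fin_dim_innerI: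
  assumes "finite (B :: 'a::real_inner set)" "span B = UNIV"
  shows "\<exists>B. finite B \<and> (\<forall>x::'a. \<exists>c. x = (\<Sum>b\<in>B. c b *\<^sub>R b))"
  using assms span_finite[of B] by (intro exI[of _ B]) auto

instance euclidean_space \<subseteq> fin_dim_inner
  by standard (rule fin_dim_innerI[OF finite_Basis span_Basis])

instance prod :: (fin_dim_inner, fin_dim_inner) fin_dim_inner
proof
  obtain B :: "'a set" and C :: "'b set"
    where B: "finite B" "span B = UNIV" and C: "finite C" "span C = UNIV"
    using finite_span by metis
  let ?D = "(\<lambda>b. (b, 0)) ` B \<union> (\<lambda>c. (0, c)) ` C"
  have "(x, y) \<in> span ?D" for x :: 'a and y :: 'b
  proof -
    have "linear (\<lambda>b::'a. (b, 0::'b))" "linear (\<lambda>c::'b. (0::'a, c))"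
      by (auto intro!: linearI)
    then have "span ((\<lambda>b. (b, 0::'b)) ` B) = range (\<lambda>b. (b, 0))"
      and "span ((\<lambda>c. (0::'a, c)) ` C) = range (\<lambda>c. (0, c))"
      using B C by (simp_all add: linear_span_image)
    then have "(x, 0) \<in> span ?D" "(0, y) \<in> span ?D"
      using span_mono[of _ ?D] by blast+
    then have "(x, 0) + (0, y) \<in> span ?D"
      by (rule span_add)
    then show ?thesis by simp
  qed
  then have "span ?D = UNIV" by auto
  then show "\<exists>D. finite D \<and> (\<forall>x :: 'a \<times> 'b. \<exists>c. x = (\<Sum>b\<in>D. c b *\<^sub>R b))"
    using B C by (intro fin_dim_innerI[of ?D]) auto
qed

text \<open>Since \<open>unit\<close> is a model space, dimension zero is indeed covered.\<close>

instantiation unit :: real_inner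
begin
definition zero_unit :: unit where "zero_unit = ()"
definition plus_unit :: "unit \<Rightarrow> unit \<Rightarrow> unit" where "plus_unit x y = ()"
definition scaleR_unit :: "real \<Rightarrow> unit \<Rightarrow> unit" where "scaleR_unit r x = ()"
definition inner_unit :: "unit \<Rightarrow> unit \<Rightarrow> real" where "inner_unit x y = 0"
definition norm_unit :: "unit \<Rightarrow> real" where "norm_unit x = 0"
definition dist_unit :: "unit \<Rightarrow> unit \<Rightarrow> real" where "dist_unit x y = 0"
definition sgn_unit :: "unit \<Rightarrow> unit" where "sgn_unit x = ()"
definition uniformity_unit :: "(unit \<times> unit) filter"
  where "uniformity_unit = (INF e\<in>{0<..}. principal {(x, y). dist x y < e})"
definition open_unit :: "unit set \<Rightarrow> bool"
  where "open_unit U = (\<forall>x\<in>U. \<forall>\<^sub>F (x', y) in uniformity. x' = x \<longrightarrow> y \<in> U)"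
instance
  by standard (simp_all add: inner_unit_def norm_unit_def dist_unit_def
      uniformity_unit_def open_unit_def)
end

instance unit :: fin_dim_inner
  by standard (rule exI[of _ UNIV], simp)


section \<open>Smooth manifolds and smooth maps\<close>

text \<open>\<open>Ck_on k f S\<close> is used for open \<open>S\<close> in a finite-dimensional space, where it is the usual C^k.\<close>

primrec Ck_on :: "nat \<Rightarrow> ('a::real_normed_vector \<Rightarrow> 'b::real_normed_vector) \<Rightarrow> 'a set \<Rightarrow> bool" where
  "Ck_on 0 f S \<longleftrightarrow> continuous_on S f"
| "Ck_on (Suc k) f S \<longleftrightarrow> (\<forall>x\<in>S. f differentiable (at x)) \<and>
     (\<forall>v. Ck_on k (\<lambda>x. frechet_derivative f (at x) v) S)"

definition smooth_on :: "('a::real_normed_vector \<Rightarrow> 'b::real_normed_vector) \<Rightarrow> 'a set \<Rightarrow> bool" where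
  "smooth_on f S \<longleftrightarrow> (\<forall>k. Ck_on k f S)"

text \<open>A chart is its domain with a coordinate map, whose values off the domain are irrelevant.\<close>

type_synonym ('m, 'a) atlas = "('m set \<times> ('m \<Rightarrow> 'a)) set"

definition is_chart :: "'m::topological_space set \<Rightarrow> ('m \<Rightarrow> 'a::fin_dim_inner) \<Rightarrow> bool" where
  "is_chart U \<phi> \<longleftrightarrow> open U \<and> open (\<phi> ` U) \<and> homeomorphism U (\<phi> ` U) \<phi> (inv_into U \<phi>)"

text \<open>The underlying set of the manifold is the whole type \<open>'m\<close>, with its class topology.\<close>

locale smooth_manifold =
  fixes A :: "('m::{t2_space, second_countable_topology}, 'a::fin_dim_inner) atlas"
  assumes charts: "(U, \<phi>) \<in> A \<Longrightarrow> is_chart U \<phi>"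
    and cover: "(\<Union>(U, \<phi>)\<in>A. U) = UNIV"
    and compatible: "(U, \<phi>) \<in> A \<Longrightarrow> (V, \<psi>) \<in> A \<Longrightarrow>
          smooth_on (\<psi> \<circ> inv_into U \<phi>) (\<phi> ` (U \<inter> V))"

definition prod_atlas :: "('m, 'a) atlas \<Rightarrow> ('n, 'b) atlas \<Rightarrow> ('m \<times> 'n, 'a \<times> 'b) atlas" where
  "prod_atlas A B = {(U \<times> V, map_prod \<phi> \<psi>) | U \<phi> V \<psi>. (U, \<phi>) \<in> A \<and> (V, \<psi>) \<in> B}"

text \<open>Smoothness on an open subset \<open>W\<close>, regarded as an open submanifold.\<close>

definition smooth_map ::
  "('m::topological_space, 'a::fin_dim_inner) atlas \<Rightarrow> 'm set \<Rightarrow>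
   ('n::topological_space, 'b::fin_dim_inner) atlas \<Rightarrow> ('m \<Rightarrow> 'n) \<Rightarrow> bool" where
  "smooth_map A W B f \<longleftrightarrow> open W \<and> continuous_on W f \<and>
     (\<forall>(U, \<phi>)\<in>A. \<forall>(V, \<psi>)\<in>B.
        smooth_on (\<psi> \<circ> f \<circ> inv_into U \<phi>) (\<phi> ` (U \<inter> W \<inter> f -` V)))"

definition smooth_funs :: "('m::topological_space, 'a::fin_dim_inner) atlas \<Rightarrow> ('m \<Rightarrow> real) set" where
  "smooth_funs A = {f. smooth_map A UNIV {(UNIV, id)} f}"


section \<open>Tangent vectors and vector fields\<close>

type_synonym 'm tangent = "('m \<Rightarrow> real) \<Rightarrow> real"
type_synonym 'm vfield = "'m \<Rightarrow> 'm tangent"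

text \<open>
  Tangent vectors are derivations of the algebra of smooth functions. They are set to zero on
  non-smooth functions, so that equality of tangent vectors is equality in HOL.
\<close>

definition tangent_space ::
  "('m::topological_space, 'a::fin_dim_inner) atlas \<Rightarrow> 'm \<Rightarrow> 'm tangent set" where
  "tangent_space A p = {D.
     (\<forall>f. f \<notin> smooth_funs A \<longrightarrow> D f = 0) \<and>
     (\<forall>f\<in>smooth_funs A. \<forall>g\<in>smooth_funs A. D (\<lambda>x. f x + g x) = D f + D g) \<and>
     (\<forall>c. \<forall>f\<in>smooth_funs A. D (\<lambda>x. c * f x) = c * D f) \<and>
     (\<forall>f\<in>smooth_funs A. \<forall>g\<in>smooth_funs A. D (\<lambda>x. f x * g x) = f p * D g + g p * D f)}"

definition vector_fields ::
  "('m::topological_space, 'a::fin_dim_inner) atlas \<Rightarrow> 'm vfield set" where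
  "vector_fields A = {X. (\<forall>p. X p \<in> tangent_space A p) \<and>
     (\<forall>f\<in>smooth_funs A. (\<lambda>p. X p f) \<in> smooth_funs A)}"

definition vf_add :: "'m vfield \<Rightarrow> 'm vfield \<Rightarrow> 'm vfield" where
  "vf_add X Y = (\<lambda>p f. X p f + Y p f)"

definition vf_scale :: "real \<Rightarrow> 'm vfield \<Rightarrow> 'm vfield" where
  "vf_scale c X = (\<lambda>p f. c * X p f)"

definition vf_bracket :: "'m vfield \<Rightarrow> 'm vfield \<Rightarrow> 'm vfield" where
  "vf_bracket X Y = (\<lambda>p f. X p (\<lambda>q. Y q f) - Y p (\<lambda>q. X q f))"

definition vf_supp :: "'m::topological_space vfield \<Rightarrow> 'm set" where
  "vf_supp X = closure {p. X p \<noteq> (\<lambda>f. 0)}"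

definition compact_vector_fields ::
  "('m::topological_space, 'a::fin_dim_inner) atlas \<Rightarrow> 'm vfield set" where
  "compact_vector_fields A = {X \<in> vector_fields A. compact (vf_supp X)}"

definition lie_algebra_hom ::
  "'m vfield set \<Rightarrow> 'n vfield set \<Rightarrow> ('m vfield \<Rightarrow> 'n vfield) \<Rightarrow> bool" where
  "lie_algebra_hom S T \<sigma> \<longleftrightarrow> \<sigma> ` S \<subseteq> T \<and>
     (\<forall>v\<in>S. \<forall>w\<in>S. \<sigma> (vf_add v w) = vf_add (\<sigma> v) (\<sigma> w)) \<and>
     (\<forall>c. \<forall>v\<in>S. \<sigma> (vf_scale c v) = vf_scale c (\<sigma> v)) \<and>
     (\<forall>v\<in>S. \<forall>w\<in>S. \<sigma> (vf_bracket v w) = vf_bracket (\<sigma> v) (\<sigma> w))"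

text \<open>
  The image of a tangent vector under the derivative of \<open>F\<close>, where \<open>B\<close> is the atlas of the
  codomain.
\<close>

definition differential ::
  "('n::topological_space, 'b::fin_dim_inner) atlas \<Rightarrow> ('m \<Rightarrow> 'n) \<Rightarrow> 'm tangent \<Rightarrow> 'n tangent" where
  "differential B F D = (\<lambda>f. if f \<in> smooth_funs B then D (f \<circ> F) else 0)"

text \<open>
  For surjective \<open>F\<close> there is at most one \<open>v\<close> as below; for invariant \<open>w\<close> on a principal bundle
  with projection \<open>F\<close> it exists.
\<close>

definition pushforward ::
  "('n::topological_space, 'b::fin_dim_inner) atlas \<Rightarrow> ('m \<Rightarrow> 'n) \<Rightarrow> 'm vfield \<Rightarrow> 'n vfield" where
  "pushforward B F w = (THE v. \<forall>p. differential B F (w p) = v (F p))"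


section \<open>Lie groups and principal bundles\<close>

locale lie_group = smooth_manifold A + Groups.group mult e ginv
  for A :: "('g::{t2_space, second_countable_topology}, 'b::fin_dim_inner) atlas"
    and mult :: "'g \<Rightarrow> 'g \<Rightarrow> 'g" and e :: 'g and ginv :: "'g \<Rightarrow> 'g" +
  assumes smooth_mult: "smooth_map (prod_atlas A A) UNIV A (\<lambda>(g, h). mult g h)"
    and smooth_ginv: "smooth_map A UNIV A ginv"

locale principal_bundle =
  M: smooth_manifold AM + P: smooth_manifold AP + G: lie_group AG mult e ginv
  for AM :: "('m::{t2_space, second_countable_topology}, 'a::fin_dim_inner) atlas"
    and AP :: "('p::{t2_space, second_countable_topology}, 'c::fin_dim_inner) atlas"
    and AG :: "('g::{t2_space, second_countable_topology}, 'b::fin_dim_inner) atlas"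
    and mult :: "'g \<Rightarrow> 'g \<Rightarrow> 'g" and e :: 'g and ginv :: "'g \<Rightarrow> 'g" +
  fixes \<pi> :: "'p \<Rightarrow> 'm"
    and act :: "'p \<Rightarrow> 'g \<Rightarrow> 'p"
  assumes smooth_proj: "smooth_map AP UNIV AM \<pi>"
    and smooth_act: "smooth_map (prod_atlas AP AG) UNIV AP (\<lambda>(p, g). act p g)"
    and act_e: "act p e = p"
    and act_mult: "act p (mult g h) = act (act p g) h"
    and proj_act: "\<pi> (act p g) = \<pi> p"
    and locally_trivial: "\<exists>U \<phi>. x \<in> U \<and> open U \<and>
          bij_betw \<phi> (\<pi> -` U) (U \<times> UNIV) \<and>
          smooth_map AP (\<pi> -` U) (prod_atlas AM AG) \<phi> \<and>
          smooth_map (prod_atlas AM AG) (U \<times> UNIV) AP (inv_into (\<pi> -` U) \<phi>) \<and>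
          (\<forall>p\<in>\<pi> -` U. fst (\<phi> p) = \<pi> p \<and>
             (\<forall>g. \<phi> (act p g) = (\<pi> p, mult (snd (\<phi> p)) g)))"

definition invariant_vector_fields ::
  "('p::topological_space, 'c::fin_dim_inner) atlas \<Rightarrow> ('p \<Rightarrow> 'm::topological_space) \<Rightarrow>
   ('p \<Rightarrow> 'g \<Rightarrow> 'p) \<Rightarrow> 'p vfield set" where
  "invariant_vector_fields AP \<pi> act = {w \<in> vector_fields AP.
     (\<forall>p g. differential AP (\<lambda>q. act q g) (w p) = w (act p g)) \<and>
     compact (\<pi> ` vf_supp w)}"

end

theory Submission
  imports Defs
begin

text \<open>
  Let \<open>v\<close> vanish near \<open>x\<close> and let \<open>p\<close> lie over \<open>x\<close>. The theorem amounts to \<open>\<sigma>(v)\<close> being zero at \<open>p\<close>.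
  Consider the Lie algebra \<open>L\<close> of all compactly supported fields on \<open>M\<close> whose support avoids \<open>x\<close>, and
  in it the kernel \<open>J\<close> of the linear map \<open>w \<mapsto> \<sigma>(w)\<^sub>p\<close>. This map takes values in the finite-dimensional
  space \<open>T\<^sub>pP\<close>, so \<open>J\<close> has finite codimension in \<open>L\<close>.

  Moreover \<open>J\<close> is an ideal of \<open>L\<close>. If \<open>\<sigma>(v)\<close> vanishes at \<open>p\<close>, it vanishes on the whole fibre over \<open>x\<close> by
  invariance. For \<open>w \<in> L\<close> the vector \<open>\<sigma>(w)\<^sub>p\<close> projects to \<open>w\<^sub>x = 0\<close>, hence is tangent to that fibre, and it
  annihilates all functions that vanish there (\<open>vertical_tangent_to_fibre\<close>). So both terms of the bracket
  \<open>[\<sigma>(v), \<sigma>(w)] = \<sigma>([v, w])\<close> are zero at \<open>p\<close>.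

  But \<open>L\<close> has no proper ideal of finite codimension (\<open>no_finite_codim_ideal\<close>), so \<open>J = L\<close>. By cutting off with
  bump functions, this comes down to fields \<open>f X\<close> for a single \<open>X\<close> that looks like a coordinate field
  \<open>\<partial>/\<partial>y\<close> in the region of interest. Among the polynomials in \<open>y\<close> there is a nonconstant \<open>f\<close> with
  \<open>f X \<in> J\<close>, by finite codimension; brackets with further multiples of \<open>X\<close> turn this single member into an
  ideal of functions \<open>h\<close> with \<open>h q(y) X \<in> J\<close> for a nonzero polynomial \<open>q\<close>, and repeated brackets with \<open>X\<close>
  itself differentiate \<open>q\<close> down to a nonzero constant (\<open>derivative_ideal_subset\<close>).

  Tangent vectors being derivations, two analytic ingredients are used throughout: bump functions, which make
  derivations local, and Hadamard's lemma, which makes them combinations of partial derivatives in a chart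
  (\<open>tangent_expand\<close>).
\<close>

section \<open>Orthonormal bases of model spaces\<close>

definition orthonormal :: "'a::real_inner set \<Rightarrow> bool" where
  "orthonormal B \<longleftrightarrow> finite B \<and> (\<forall>b\<in>B. \<forall>c\<in>B. b \<bullet> c = (if b = c then 1 else 0))"

lemma gram_schmidt:
  assumes "finite (B :: 'a::real_inner set)"
  shows "\<exists>C. orthonormal C \<and> span B \<subseteq> span C"
  using assms
proof (induction B)
  case empty
  show ?case by (intro exI[of _ "{}"]) (auto simp: orthonormal_def)
next
  case (insert a B)
  then obtain C where C: "orthonormal C" "span B \<subseteq> span C" by blast
  have fin: "finite C" using C by (simp add: orthonormal_def)
  define s where "s = (\<Sum>c\<in>C. (a \<bullet> c) *\<^sub>R c)"
  define r where "r = a - s"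
  have s: "s \<in> span C" unfolding s_def by (intro span_sum span_scale span_base)
  have orth: "r \<bullet> d = 0" if "d \<in> C" for d
  proof -
    have "s \<bullet> d = (\<Sum>c\<in>C. (a \<bullet> c) * (if c = d then 1 else 0))"
      unfolding s_def inner_sum_left using C that by (intro sum.cong) (auto simp: orthonormal_def)
    also have "\<dots> = a \<bullet> d" using fin that by (simp add: mult_delta_right)
    finally show ?thesis by (simp add: r_def inner_diff_left)
  qed
  show ?case
  proof (cases "r = 0")
    case True
    then have "a \<in> span C" using s by (simp add: r_def)
    then have "insert a B \<subseteq> span C" using C(2) span_superset[of B] by auto
    then show ?thesis using C(1) span_minimal[OF _ subspace_span] by blast
  next
    case False
    define e where "e = r /\<^sub>R norm r"
    have ee: "e \<bullet> e = 1" using False by (simp add: e_def dot_square_norm power2_eq_square)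
    have ec: "e \<bullet> c = 0" "c \<bullet> e = 0" if "c \<in> C" for c
      using orth[OF that] by (simp_all add: e_def inner_commute)
    have on: "orthonormal (insert e C)"
      using C(1) ee ec fin by (auto simp: orthonormal_def)
    have "a = norm r *\<^sub>R e + s" using False by (simp add: e_def r_def)
    moreover have "norm r *\<^sub>R e + s \<in> span (insert e C)"
      using s span_mono[of C "insert e C"] by (intro span_add span_scale) (auto intro: span_base)
    ultimately have "insert a B \<subseteq> span (insert e C)"
      using C(2) span_superset[of B] span_mono[of C "insert e C"] by (metis (no_types) insert_subset order_trans subset_insertI)
    then show ?thesis using on span_minimal[OF _ subspace_span] by blast
  qed
qed

definition onb :: "'a::fin_dim_inner set" where
  "onb = (SOME B. orthonormal B \<and> span B = UNIV)"

lemma onb: "orthonormal (onb :: 'a::fin_dim_inner set)" "span (onb :: 'a set) = UNIV"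
proof -
  obtain B :: "'a set" where "finite B" "span B = UNIV" using finite_span by blast
  then have "\<exists>C :: 'a set. orthonormal C \<and> span C = UNIV" using gram_schmidt[of B] by auto
  from someI_ex[OF this] show "orthonormal (onb :: 'a set)" "span (onb :: 'a set) = UNIV"
    by (simp_all add: onb_def)
qed

lemma finite_onb [simp]: "finite (onb :: 'a::fin_dim_inner set)"
  using onb(1)[where 'a='a] by (simp add: orthonormal_def)

lemma onb_inner: "(b :: 'a::fin_dim_inner) \<in> onb \<Longrightarrow> c \<in> onb \<Longrightarrow> b \<bullet> c = (if b = c then 1 else 0)"
  using onb(1)[where 'a='a] by (simp add: orthonormal_def)

lemma onb_expansion: "(x :: 'a::fin_dim_inner) = (\<Sum>b\<in>onb. (x \<bullet> b) *\<^sub>R b)"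
proof -
  have "x \<in> span onb" by (simp add: onb)
  then obtain u where u: "x = (\<Sum>b\<in>onb. u b *\<^sub>R b)"
    using span_finite[OF finite_onb, where 'a1='a] by auto
  have "x \<bullet> b = u b" if "b \<in> onb" for b
  proof -
    have "x \<bullet> b = (\<Sum>c\<in>onb. u c * (if c = b then 1 else 0))"
      unfolding u inner_sum_left using that by (intro sum.cong) (auto simp: onb_inner)
    then show ?thesis using that by (simp add: mult_delta_right)
  qed
  then show ?thesis using u by simp
qed

lemma linear_onb_expansion:
  fixes x :: "'a::fin_dim_inner"
  assumes "linear f"
  shows "f x = (\<Sum>b\<in>onb. (x \<bullet> b) *\<^sub>R f b)"
  by (subst onb_expansion[of x]) (simp add: linear_sum[OF assms] linear_cmul[OF assms])

text \<open>
  Compactness of closed balls is needed for bump functions with compact support, completeness for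
  differentiation under the integral sign.
\<close>

instance fin_dim_inner \<subseteq> heine_borel
proof
  fix f :: "nat \<Rightarrow> 'a"
  assume f: "bounded (range f)"
  have bd: "bounded ((\<lambda>x. x \<bullet> i) ` range f)" for i
    by (rule bounded_linear_image[OF f bounded_linear_inner_left])
  let ?un = "\<lambda>u. \<Sum>i\<in>onb. u i *\<^sub>R (i::'a)"
  have un: "?un u \<bullet> i = u i" if "i \<in> onb" for u and i :: 'a
  proof -
    have "?un u \<bullet> i = (\<Sum>c\<in>onb. u c * (if c = i then 1 else 0))"
      unfolding inner_sum_left using that by (intro sum.cong) (auto simp: onb_inner)
    then show ?thesis using that by (simp add: mult_delta_right)
  qed
  have "\<forall>d\<subseteq>onb. \<exists>l::'a. \<exists>r. strict_mono r \<and>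
      (\<forall>e>0. eventually (\<lambda>n. \<forall>i\<in>d. dist (f (r n) \<bullet> i) (l \<bullet> i) < e) sequentially)"
    by (rule compact_lemma_general[where unproj="?un"])
       (use bd un in \<open>auto simp: image_image onb_expansion[symmetric]\<close>)
  then obtain l :: 'a and r where r: "strict_mono r"
    and lr: "\<And>e. e > 0 \<Longrightarrow> eventually (\<lambda>n. \<forall>i\<in>onb. dist (f (r n) \<bullet> i) (l \<bullet> i) < e) sequentially"
    by blast
  have "(\<lambda>n. (f \<circ> r) n \<bullet> i) \<longlonglongrightarrow> l \<bullet> i" if "i \<in> onb" for i
    using that by (auto simp: tendsto_iff elim!: eventually_mono[OF lr])
  then have "(\<lambda>n. \<Sum>i\<in>onb. ((f \<circ> r) n \<bullet> i) *\<^sub>R i) \<longlonglongrightarrow> (\<Sum>i\<in>onb. (l \<bullet> i) *\<^sub>R i)"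
    by (intro tendsto_sum tendsto_scaleR tendsto_const)
  then have "(f \<circ> r) \<longlonglongrightarrow> l" by (simp add: onb_expansion[symmetric] o_def)
  with r show "\<exists>l r. strict_mono r \<and> (f \<circ> r) \<longlonglongrightarrow> l" by auto
qed

instance fin_dim_inner \<subseteq> banach ..

section \<open>Calculus of smooth maps\<close>

lemma Ck_on_subset: "Ck_on k f S \<Longrightarrow> T \<subseteq> S \<Longrightarrow> Ck_on k f T"
proof (induction k arbitrary: f)
  case 0 then show ?case by (auto intro: continuous_on_subset)
next
  case (Suc k) then show ?case by (simp; blast)
qed

lemma Ck_on_Suc: "Ck_on (Suc k) f S \<Longrightarrow> Ck_on k f S"
proof (induction k arbitrary: f)
  case 0
  then show ?case
    by (auto intro!: continuous_at_imp_continuous_on differentiable_imp_continuous_within)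
next
  case (Suc k)
  then show ?case by (metis Ck_on.simps(2))
qed

lemma Ck_on_continuous: "Ck_on k f S \<Longrightarrow> continuous_on S f"
proof (induction k)
  case (Suc k) then show ?case using Ck_on_Suc by blast
qed simp

lemma Ck_on_cong:
  assumes "open S"
  shows "(\<And>x. x \<in> S \<Longrightarrow> f x = g x) \<Longrightarrow> Ck_on k f S \<Longrightarrow> Ck_on k g S"
proof (induction k arbitrary: f g)
  case 0 then show ?case by (simp cong: continuous_on_cong)
next
  case (Suc k)
  have d: "(g has_derivative frechet_derivative f (at x)) (at x)" if "x \<in> S" for x
    using that Suc.prems assms
    by (intro has_derivative_transform_within_open[of f _ x UNIV S g])
       (auto simp: frechet_derivative_works[symmetric])
  have e: "frechet_derivative g (at x) = frechet_derivative f (at x)" if "x \<in> S" for x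
    using frechet_derivative_at[OF d[OF that]] by simp
  have "Ck_on k (\<lambda>x. frechet_derivative g (at x) v) S" for v
    by (rule Suc.IH[of "\<lambda>x. frechet_derivative f (at x) v"]) (use e Suc.prems in auto)
  with d show ?case by (auto simp: differentiable_def)
qed

lemma Ck_on_local:
  assumes "\<And>x. x \<in> S \<Longrightarrow> \<exists>T. open T \<and> x \<in> T \<and> Ck_on k f T"
  shows "Ck_on k f S"
  using assms
proof (induction k arbitrary: f)
  case 0
  show ?case
  proof (simp, intro continuous_at_imp_continuous_on ballI)
    fix x assume "x \<in> S"
    then obtain T where "open T" "x \<in> T" "continuous_on T f" using 0[of x] by auto
    then show "isCont f x" by (simp add: continuous_on_eq_continuous_at)
  qed
next
  case (Suc k)
  have "Ck_on k (\<lambda>x. frechet_derivative f (at x) v) S" for v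
  proof (rule Suc.IH)
    fix x assume "x \<in> S"
    then obtain T where "open T" "x \<in> T" "Ck_on (Suc k) f T" using Suc.prems by blast
    then show "\<exists>T. open T \<and> x \<in> T \<and> Ck_on k (\<lambda>x. frechet_derivative f (at x) v) T"
      by (intro exI[of _ T]) simp
  qed
  moreover have "f differentiable (at x)" if x: "x \<in> S" for x
  proof -
    obtain T where "x \<in> T" "Ck_on (Suc k) f T" using Suc.prems x by blast
    then show ?thesis by simp
  qed
  ultimately show ?case by simp
qed

text \<open>
  The derivative is typically known from a differentiation rule; this avoids the description operator in
  \<open>frechet_derivative\<close>.
\<close>

lemma Ck_on_SucI:
  assumes "open S" "\<And>x. x \<in> S \<Longrightarrow> (f has_derivative f' x) (at x)"
    and "\<And>v. Ck_on k (\<lambda>x. f' x v) S"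
  shows "Ck_on (Suc k) f S"
proof -
  have "Ck_on k (\<lambda>x. frechet_derivative f (at x) v) S" for v
    by (rule Ck_on_cong[OF assms(1) _ assms(3)]) (simp add: frechet_derivative_at[OF assms(2), symmetric])
  then show ?thesis using assms(2) by (auto simp: differentiable_def)
qed

lemma Ck_on_SucD:
  assumes "Ck_on (Suc k) f S"
  shows "x \<in> S \<Longrightarrow> (f has_derivative frechet_derivative f (at x)) (at x)"
    and "Ck_on k (\<lambda>x. frechet_derivative f (at x) v) S"
  using assms by (auto simp: frechet_derivative_works[symmetric])

lemma Ck_on_const: "open S \<Longrightarrow> Ck_on k (\<lambda>x. c) S"
proof (induction k arbitrary: c)
  case (Suc k)
  show ?case by (rule Ck_on_SucI[where f' = "\<lambda>x v. 0"]) (use Suc in auto)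
qed simp

lemma Ck_on_bounded_linear:
  assumes "bounded_linear L" "open S"
  shows "Ck_on k f S \<Longrightarrow> Ck_on k (\<lambda>x. L (f x)) S"
proof (induction k arbitrary: f)
  case 0 then show ?case using assms by (auto intro: bounded_linear.continuous_on)
next
  case (Suc k)
  note d = Ck_on_SucD[OF Suc.prems]
  show ?case
    by (rule Ck_on_SucI[OF assms(2) bounded_linear.has_derivative[OF assms(1) d(1)] Suc.IH[OF d(2)]])
qed

lemma Ck_on_id: "open S \<Longrightarrow> Ck_on k (\<lambda>x. x) S"
  by (cases k) (simp, metis Ck_on_SucI[where f' = "\<lambda>x v. v"] Ck_on_const has_derivative_ident)

lemma Ck_on_linear: "bounded_linear L \<Longrightarrow> open S \<Longrightarrow> Ck_on k L S"
  using Ck_on_bounded_linear[OF _ _ Ck_on_id] .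

lemma Ck_on_add:
  assumes "open S"
  shows "Ck_on k f S \<Longrightarrow> Ck_on k g S \<Longrightarrow> Ck_on k (\<lambda>x. f x + g x) S"
proof (induction k arbitrary: f g)
  case 0 then show ?case by (auto intro: continuous_intros)
next
  case (Suc k)
  note d = Ck_on_SucD[OF Suc.prems(1)] Ck_on_SucD[OF Suc.prems(2)]
  show ?case
    by (rule Ck_on_SucI[OF assms has_derivative_add[OF d(1) d(3)] Suc.IH[OF d(2) d(4)]])
qed

lemma Ck_on_sum:
  assumes "open S" "\<And>i. i \<in> I \<Longrightarrow> Ck_on k (f i) S"
  shows "Ck_on k (\<lambda>x. \<Sum>i\<in>I. f i x) S"
  using assms(2)
  by (induction I rule: infinite_finite_induct) (auto intro: Ck_on_const Ck_on_add assms(1))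

lemma Ck_on_scaleR:
  assumes "open S"
  shows "Ck_on k f S \<Longrightarrow> Ck_on k g S \<Longrightarrow> Ck_on k (\<lambda>x. f x *\<^sub>R g x) S"
proof (induction k arbitrary: f g)
  case 0 then show ?case by (auto intro: continuous_intros)
next
  case (Suc k)
  note d = Ck_on_SucD[OF Suc.prems(1)] Ck_on_SucD[OF Suc.prems(2)]
  show ?case
    by (rule Ck_on_SucI[OF assms has_derivative_scaleR[OF d(1) d(3)]
          Ck_on_add[OF assms Suc.IH[OF Ck_on_Suc[OF Suc.prems(1)] d(4)]
            Suc.IH[OF d(2) Ck_on_Suc[OF Suc.prems(2)]]]])
qed

text \<open>
  The direction in which \<open>g\<close> is differentiated varies with the point. Expanding it in an orthonormal basis
  turns the chain rule into a finite sum of products of \<open>C^k\<close> functions.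
\<close>

lemma Ck_on_compose:
  fixes f :: "'a::real_normed_vector \<Rightarrow> 'b::fin_dim_inner"
  assumes S: "open S" and T: "open T" and fS: "f ` S \<subseteq> T"
  shows "Ck_on k f S \<Longrightarrow> Ck_on k g T \<Longrightarrow> Ck_on k (\<lambda>x. g (f x)) S"
  using fS
proof (induction k arbitrary: g)
  case 0 then show ?case by (auto intro: continuous_on_compose2)
next
  case (Suc k)
  note df = Ck_on_SucD[OF Suc.prems(1)] and dg = Ck_on_SucD[OF Suc.prems(2)]
  let ?f' = "\<lambda>x. frechet_derivative f (at x)" and ?g' = "\<lambda>y. frechet_derivative g (at y)"
  let ?d = "\<lambda>x v. \<Sum>b\<in>onb. (?f' x v \<bullet> b) *\<^sub>R ?g' (f x) b"
  show ?case
  proof (rule Ck_on_SucI[OF S, where f' = ?d])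
    fix x assume x: "x \<in> S"
    then have fx: "f x \<in> T" using fS by auto
    have "((\<lambda>x. g (f x)) has_derivative (\<lambda>v. ?g' (f x) (?f' x v))) (at x)"
      using has_derivative_compose[OF df(1)[OF x] dg(1)[OF fx]] .
    moreover have "(\<lambda>v. ?g' (f x) (?f' x v)) = ?d x"
      by (rule ext) (rule linear_onb_expansion[OF has_derivative_linear[OF dg(1)[OF fx]]])
    ultimately show "((\<lambda>x. g (f x)) has_derivative ?d x) (at x)"
      by (simp only:)
  next
    fix v
    show "Ck_on k (\<lambda>x. ?d x v) S"
      by (intro Ck_on_sum Ck_on_scaleR S Ck_on_bounded_linear[OF bounded_linear_inner_left]
          df(2) Suc.IH Ck_on_Suc[OF Suc.prems(1)] dg(2) fS)
  qed
qed

lemma smooth_on_subset: "smooth_on f S \<Longrightarrow> T \<subseteq> S \<Longrightarrow> smooth_on f T"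
  by (auto simp: smooth_on_def intro: Ck_on_subset)

lemma smooth_on_cong:
  "smooth_on f S \<Longrightarrow> open S \<Longrightarrow> (\<And>x. x \<in> S \<Longrightarrow> f x = g x) \<Longrightarrow> smooth_on g S"
  by (auto simp: smooth_on_def intro: Ck_on_cong[of S f g])

lemma smooth_on_local:
  "(\<And>x. x \<in> S \<Longrightarrow> \<exists>T. open T \<and> x \<in> T \<and> smooth_on f T) \<Longrightarrow> smooth_on f S"
  unfolding smooth_on_def by (intro allI Ck_on_local) blast

lemma smooth_on_continuous: "smooth_on f S \<Longrightarrow> continuous_on S f"
  unfolding smooth_on_def using Ck_on.simps(1)[of f S] by blast

lemma smooth_on_has_derivative:
  "smooth_on f S \<Longrightarrow> x \<in> S \<Longrightarrow> (f has_derivative frechet_derivative f (at x)) (at x)"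
  unfolding smooth_on_def by (rule Ck_on_SucD(1)[where k=0 and S=S]) auto

lemma smooth_on_derivative:
  "smooth_on f S \<Longrightarrow> smooth_on (\<lambda>x. frechet_derivative f (at x) v) S"
  unfolding smooth_on_def by (intro allI Ck_on_SucD(2)) auto

lemma smooth_on_const: "open S \<Longrightarrow> smooth_on (\<lambda>x. c) S"
  by (simp add: smooth_on_def Ck_on_const)

lemma smooth_on_linear: "bounded_linear L \<Longrightarrow> open S \<Longrightarrow> smooth_on L S"
  by (simp add: smooth_on_def Ck_on_linear)

lemma smooth_on_add:
  "smooth_on f S \<Longrightarrow> smooth_on g S \<Longrightarrow> open S \<Longrightarrow> smooth_on (\<lambda>x. f x + g x) S"
  by (simp add: smooth_on_def Ck_on_add)

lemma smooth_on_sum: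
  "open S \<Longrightarrow> (\<And>i. i \<in> I \<Longrightarrow> smooth_on (f i) S) \<Longrightarrow> smooth_on (\<lambda>x. \<Sum>i\<in>I. f i x) S"
  by (simp add: smooth_on_def Ck_on_sum)

lemma smooth_on_mult:
  fixes f g :: "'a::real_normed_vector \<Rightarrow> real"
  shows "smooth_on f S \<Longrightarrow> smooth_on g S \<Longrightarrow> open S \<Longrightarrow> smooth_on (\<lambda>x. f x * g x) S"
  unfolding smooth_on_def using Ck_on_scaleR[of S _ f g] by simp

lemma smooth_on_compose:
  fixes f :: "'a::real_normed_vector \<Rightarrow> 'b::fin_dim_inner"
  assumes "smooth_on f S" "smooth_on g T" "open S" "open T" "f ` S \<subseteq> T"
  shows "smooth_on (\<lambda>x. g (f x)) S"
  using assms by (auto simp: smooth_on_def intro: Ck_on_compose)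

section \<open>A smooth plateau function\<close>

text \<open>
  The family of all \<open>p(1/t) exp(-1/t)\<close>, with \<open>p\<close> a polynomial, is closed under differentiation, so that
  smoothness of its members needs only one computation, including the one at zero.
\<close>

definition flat_exp :: "real poly \<Rightarrow> real \<Rightarrow> real" where
  "flat_exp p t = (if t \<le> 0 then 0 else poly p (1 / t) * exp (- (1 / t)))"

lemma poly_exp_decay: "((\<lambda>s::real. poly p s * exp (- s)) \<longlongrightarrow> 0) at_top"
proof -
  have "((\<lambda>s::real. \<Sum>i\<le>degree p. coeff p i * (s ^ i / exp s)) \<longlongrightarrow> 0) at_top"
    by (intro tendsto_null_sum tendsto_mult_right_zero tendsto_power_div_exp_0)
  then show ?thesis
    by (simp only: poly_altdef sum_distrib_right exp_minus divide_inverse mult.assoc)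
qed

lemma flat_exp_has_derivative:
  "(flat_exp p has_real_derivative flat_exp (monom 1 2 * (p - pderiv p)) t) (at t)"
proof -
  consider "t < 0" | "t = 0" | "t > 0" by linarith
  then show ?thesis
  proof cases
    case 1
    have "((\<lambda>t. 0) has_real_derivative 0) (at t)" by simp
    then have "(flat_exp p has_real_derivative 0) (at t)"
      by (rule has_field_derivative_transform_within_open[where S="{..<0}"])
         (use 1 in \<open>auto simp: flat_exp_def\<close>)
    with 1 show ?thesis by (simp add: flat_exp_def)
  next
    case 2
    have "((\<lambda>s::real. poly (pCons 0 p) s * exp (- s)) \<longlongrightarrow> 0) at_top"
      by (rule poly_exp_decay)
    then have "((\<lambda>h::real. poly (pCons 0 p) (inverse h) * exp (- inverse h)) \<longlongrightarrow> 0) (at_right 0)"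
      by (rule filterlim_compose[OF _ filterlim_inverse_at_top_right])
    moreover have "eventually (\<lambda>h::real. h > 0) (at_right 0)"
      by (simp add: eventually_at_right_less)
    ultimately have r: "((\<lambda>h. flat_exp p h / h) \<longlongrightarrow> 0) (at_right 0)"
      by (elim Lim_transform_eventually eventually_mono) (simp_all add: flat_exp_def field_simps)
    have "eventually (\<lambda>h::real. h < 0) (at_left 0)"
      by (simp add: eventually_at_left_real eventually_at_left_field linordered_field_no_lb)
    then have l: "((\<lambda>h. flat_exp p h / h) \<longlongrightarrow> 0) (at_left 0)"
      by (intro tendsto_eventually) (auto elim!: eventually_mono simp: flat_exp_def)
    from l r have "((\<lambda>h. flat_exp p h / h) \<longlongrightarrow> 0) (at 0)" by (simp add: filterlim_split_at)
    with 2 show ?thesis by (simp add: DERIV_def flat_exp_def)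
  next
    case 3
    have "((\<lambda>t. poly p (1 / t) * exp (- (1 / t))) has_real_derivative
        flat_exp (monom 1 2 * (p - pderiv p)) t) (at t)"
      using 3 by (auto intro!: derivative_eq_intros
          simp: flat_exp_def poly_monom power2_eq_square field_simps)
    then show ?thesis
      by (rule has_field_derivative_transform_within_open[where S="{0<..}"])
         (use 3 in \<open>auto simp: flat_exp_def\<close>)
  qed
qed

lemma smooth_flat_exp: "smooth_on (flat_exp p) UNIV"
proof -
  have "Ck_on k (flat_exp p) UNIV" for k
  proof (induction k arbitrary: p)
    case 0
    show ?case
      by (auto intro!: continuous_at_imp_continuous_on DERIV_isCont flat_exp_has_derivative)
  next
    case (Suc k)
    have "Ck_on k (\<lambda>x. v *\<^sub>R flat_exp (monom 1 2 * (p - pderiv p)) x) UNIV" for v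
      by (intro Ck_on_scaleR Ck_on_const Suc.IH) auto
    moreover have "(flat_exp p has_derivative (\<lambda>v. v *\<^sub>R flat_exp (monom 1 2 * (p - pderiv p)) x)) (at x)" for x
    proof -
      have "(*) c = (\<lambda>v. v *\<^sub>R c)" for c :: real by auto
      then show ?thesis
        using flat_exp_has_derivative[of p x] by (simp only: has_field_derivative_def)
    qed
    ultimately show ?case
      by (intro Ck_on_SucI[where f' = "\<lambda>x v. v *\<^sub>R flat_exp (monom 1 2 * (p - pderiv p)) x"]) auto
  qed
  then show ?thesis by (simp add: smooth_on_def)
qed

text \<open>
  With \<open>\<beta>(t) = exp(-1/t)\<close> for positive \<open>t\<close> and zero otherwise, the function \<open>\<beta>(1/e - \<beta>(t))\<close> is constant where \<open>\<beta>\<close>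
  vanishes and zero as soon as \<open>\<beta>(t) \<ge> 1/e = \<beta>(1)\<close>. Nesting \<open>\<beta>\<close> in this way needs no quotient of smooth functions.
\<close>

lemma plateau:
  obtains h :: "real \<Rightarrow> real" where
    "smooth_on h UNIV" "\<And>t. t \<le> 0 \<Longrightarrow> h t = 1" "\<And>t. t \<ge> 1 \<Longrightarrow> h t = 0"
proof
  let ?\<beta> = "flat_exp 1"
  let ?h = "\<lambda>t. inverse (?\<beta> (exp (- 1))) * ?\<beta> (exp (- 1) + (- 1) * ?\<beta> t)"
  have "smooth_on (\<lambda>t. exp (- 1) + (- 1) * ?\<beta> t) UNIV"
    by (intro smooth_on_add smooth_on_mult smooth_on_const smooth_flat_exp) auto
  then have "smooth_on (\<lambda>t. ?\<beta> (exp (- 1) + (- 1) * ?\<beta> t)) UNIV"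
    by (rule smooth_on_compose[OF _ smooth_flat_exp]) auto
  then show "smooth_on ?h UNIV"
    by (intro smooth_on_mult smooth_on_const) auto
  show "?h t = 1" if "t \<le> 0" for t
    using that by (simp add: flat_exp_def)
  show "?h t = 0" if "t \<ge> 1" for t
  proof -
    have "1 / t \<le> 1" using that by simp
    then have "exp (- 1) \<le> exp (- (1 / t))" by (simp add: field_simps)
    then show ?thesis using that by (simp add: flat_exp_def)
  qed
qed

section \<open>Hadamard's lemma\<close>

lemma segment_in_ball:
  fixes a x :: "'a::real_normed_vector"
  assumes "x \<in> ball a r" "0 \<le> t" "t \<le> 1"
  shows "a + t *\<^sub>R (x - a) \<in> ball a r"
proof -
  have "norm (t *\<^sub>R (x - a)) \<le> norm (x - a)" using assms by (simp add: mult_left_le_one_le)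
  then show ?thesis using assms by (simp add: dist_norm norm_minus_commute)
qed

lemma continuous_on_segment:
  fixes h :: "'a::real_normed_vector \<Rightarrow> real"
  assumes "continuous_on (ball a r) h"
  shows "continuous_on (ball a r \<times> cbox 0 (1::real)) (\<lambda>(x, t). t ^ j * h (a + t *\<^sub>R (x - a)))"
  unfolding split_beta
  by (intro continuous_intros continuous_on_compose2[OF assms])
     (auto simp: segment_in_ball simp del: mem_ball)

text \<open>
  Differentiation under the integral sign produces a factor \<open>t\<close> by the chain rule; the weight \<open>t ^ j\<close> absorbs
  it and lets the induction on \<open>k\<close> go through.
\<close>

lemma Ck_on_ray_integral:
  fixes h :: "'a::fin_dim_inner \<Rightarrow> real"
  shows "Ck_on k h (ball a r) \<Longrightarrow>
    Ck_on k (\<lambda>x. integral (cbox 0 (1::real)) (\<lambda>t. t ^ j * h (a + t *\<^sub>R (x - a)))) (ball a r)"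
proof (induction k arbitrary: j h)
  case 0
  then show ?case by (simp add: integral_continuous_on_param continuous_on_segment del: box_real)
next
  case (Suc k)
  let ?B = "ball a r" and ?I = "cbox 0 (1::real)"
  let ?s = "\<lambda>t x. a + t *\<^sub>R (x - a)"
  let ?h' = "\<lambda>y. frechet_derivative h (at y)"
  note dh = Ck_on_SucD[OF Suc.prems]
  \<comment> \<open>the derivative of the integrand as a bounded linear map, given by its partial derivatives\<close>
  define fx where "fx x t = (\<Sum>b\<in>onb. (t ^ Suc j * ?h' (?s t x) b) *\<^sub>R blinfun_inner_left b)" for x t
  have ch: "continuous_on ?B (\<lambda>y. ?h' y b)" for b
    by (rule Ck_on_continuous[OF dh(2)])
  have h'lin: "?h' y v = (\<Sum>b\<in>onb. (v \<bullet> b) * ?h' y b)" if "y \<in> ?B" for y v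
    using linear_onb_expansion[OF has_derivative_linear[OF dh(1)[OF that]], of v] by simp
  have fx_apply: "blinfun_apply (fx x t) v = t ^ Suc j * ?h' (?s t x) v"
    if "x \<in> ?B" "t \<in> ?I" for x t v
  proof -
    have "?s t x \<in> ?B" using that by (intro segment_in_ball) auto
    then show ?thesis
      by (subst h'lin) (auto simp: fx_def blinfun.sum_left blinfun.scaleR_left sum_distrib_left
          ac_simps inner_commute intro!: sum.cong)
  qed
  have cont: "continuous_on (?B \<times> ?I) (\<lambda>(x, t). fx x t)"
    unfolding fx_def split_beta
    by (intro continuous_intros continuous_on_compose2[OF ch])
      (auto simp: segment_in_ball simp del: mem_ball)
  show ?case
  proof (rule Ck_on_SucI[where f' = "\<lambda>x v. integral ?I (\<lambda>t. t ^ Suc j * ?h' (?s t x) v)"])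
    fix x0 assume x0: "x0 \<in> ?B"
    have "((\<lambda>x. integral ?I (\<lambda>t. t ^ j * h (?s t x))) has_derivative integral ?I (fx x0))
        (at x0 within ?B)"
    proof (rule leibniz_rule[OF _ _ cont x0 convex_ball])
      fix x t assume xt: "x \<in> ?B" "t \<in> ?I"
      then have y: "?s t x \<in> ?B" by (intro segment_in_ball) auto
      have "((\<lambda>x. ?s t x) has_derivative (\<lambda>v. t *\<^sub>R v)) (at x within ?B)"
        by (auto intro!: derivative_eq_intros)
      from has_derivative_compose[OF this dh(1)[OF y]]
      have "((\<lambda>x. h (?s t x)) has_derivative (\<lambda>v. ?h' (?s t x) (t *\<^sub>R v))) (at x within ?B)" .
      from has_derivative_mult_right[OF this, of "t ^ j"]
      have "((\<lambda>x. t ^ j * h (?s t x)) has_derivative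
          (\<lambda>v. t ^ j * ?h' (?s t x) (t *\<^sub>R v))) (at x within ?B)" .
      moreover have "(\<lambda>v. t ^ j * ?h' (?s t x) (t *\<^sub>R v)) = blinfun_apply (fx x t)"
        using linear_cmul[OF has_derivative_linear[OF dh(1)[OF y]]]
        by (auto simp: fx_apply[OF xt])
      ultimately show "((\<lambda>x. t ^ j * h (?s t x)) has_derivative blinfun_apply (fx x t))
          (at x within ?B)" by simp
    next
      fix x assume x: "x \<in> ?B"
      have "continuous_on ?B h" by (rule Ck_on_continuous[OF Suc.prems])
      from continuous_on_segment[OF this, of j]
      show "(\<lambda>t. t ^ j * h (?s t x)) integrable_on ?I"
        by (intro integrable_continuous continuous_on_compose2[of "?B \<times> ?I" "\<lambda>(x, t). t ^ j * h (?s t x)" ?I "\<lambda>t. (x, t)", simplified split_conv])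
           (use x in \<open>auto intro!: continuous_intros\<close>)
    qed
    moreover have "blinfun_apply (integral ?I (fx x0)) =
        (\<lambda>v. integral ?I (\<lambda>t. t ^ Suc j * ?h' (?s t x0) v))"
    proof
      fix v
      have "fx x0 integrable_on ?I"
        by (intro integrable_continuous continuous_on_compose2[OF cont, of ?I "\<lambda>t. (x0, t)", simplified split_conv])
           (use x0 in \<open>auto intro!: continuous_intros\<close>)
      then have "blinfun_apply (integral ?I (fx x0)) v = integral ?I (\<lambda>t. blinfun_apply (fx x0 t) v)"
        by (rule blinfun_apply_integral)
      also have "\<dots> = integral ?I (\<lambda>t. t ^ Suc j * ?h' (?s t x0) v)"
        by (intro integral_cong fx_apply x0)
      finally show "blinfun_apply (integral ?I (fx x0)) v =
          integral ?I (\<lambda>t. t ^ Suc j * ?h' (?s t x0) v)" .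
    qed
    ultimately show "((\<lambda>x. integral ?I (\<lambda>t. t ^ j * h (?s t x))) has_derivative
        (\<lambda>v. integral ?I (\<lambda>t. t ^ Suc j * ?h' (?s t x0) v))) (at x0)"
      using at_within_open[OF x0 open_ball] by simp
  next
    fix v
    show "Ck_on k (\<lambda>x. integral ?I (\<lambda>t. t ^ Suc j * ?h' (?s t x) v)) ?B"
      by (rule Suc.IH[OF dh(2)])
  qed simp
qed

text \<open>Integrate the derivative of \<open>f\<close> along the segment from \<open>a\<close> to \<open>x\<close>.\<close>

lemma hadamard:
  fixes f :: "'a::fin_dim_inner \<Rightarrow> real"
  assumes f: "smooth_on f (ball a r)"
  obtains g where "\<And>b. smooth_on (g b) (ball a r)"
    and "\<And>b. g b a = frechet_derivative f (at a) b"
    and "\<And>x. x \<in> ball a r \<Longrightarrow> f x = f a + (\<Sum>b\<in>onb. ((x - a) \<bullet> b) * g b x)"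
proof
  let ?f' = "\<lambda>y. frechet_derivative f (at y)"
  let ?s = "\<lambda>t x. a + t *\<^sub>R (x - a)"
  let ?g = "\<lambda>b x. integral (cbox 0 (1::real)) (\<lambda>t. ?f' (?s t x) b)"
  show "smooth_on (?g b) (ball a r)" for b
    using smooth_on_derivative[OF f, of b] Ck_on_ray_integral[of _ "\<lambda>y. ?f' y b" a r 0]
    by (simp add: smooth_on_def)
  show "?g b a = ?f' a b" for b by simp
  fix x assume x: "x \<in> ball a r"
  have y: "?s t x \<in> ball a r" if "t \<in> {0..1}" for t
    using that by (intro segment_in_ball x) auto
  have c: "(\<lambda>t. ?f' (?s t x) b) integrable_on {0..1}" for b
    by (intro integrable_continuous_interval
        continuous_on_compose2[OF smooth_on_continuous[OF smooth_on_derivative[OF f]]])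
       (use y in \<open>auto intro!: continuous_intros\<close>)
  have "((\<lambda>t. f (?s t x)) has_vector_derivative (\<Sum>b\<in>onb. ((x - a) \<bullet> b) * ?f' (?s t x) b))
      (at t within {0..1})" if "t \<in> {0..1}" for t
  proof -
    note d = smooth_on_has_derivative[OF f y[OF that]]
    have "((\<lambda>t. ?s t x) has_derivative (\<lambda>u. u *\<^sub>R (x - a))) (at t within {0..1})"
      by (auto intro!: derivative_eq_intros)
    from has_derivative_compose[OF this d]
    have "((\<lambda>t. f (?s t x)) has_derivative (\<lambda>u. ?f' (?s t x) (u *\<^sub>R (x - a)))) (at t within {0..1})" .
    moreover have "?f' (?s t x) (u *\<^sub>R (x - a)) =
        u *\<^sub>R (\<Sum>b\<in>onb. ((x - a) \<bullet> b) * ?f' (?s t x) b)" for u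
      using linear_cmul[OF has_derivative_linear[OF d]]
        linear_onb_expansion[OF has_derivative_linear[OF d], of "x - a"] by simp
    ultimately show ?thesis by (simp add: has_vector_derivative_def)
  qed
  then have "((\<lambda>t. \<Sum>b\<in>onb. ((x - a) \<bullet> b) * ?f' (?s t x) b) has_integral
      f (?s 1 x) - f (?s 0 x)) {0..1}"
    by (intro fundamental_theorem_of_calculus) auto
  moreover have "((\<lambda>t. \<Sum>b\<in>onb. ((x - a) \<bullet> b) * ?f' (?s t x) b) has_integral
      (\<Sum>b\<in>onb. ((x - a) \<bullet> b) * integral {0..1} (\<lambda>t. ?f' (?s t x) b))) {0..1}"
    by (intro has_integral_sum has_integral_mult_right integrable_integral c) auto
  ultimately have "f (?s 1 x) - f (?s 0 x) =
      (\<Sum>b\<in>onb. ((x - a) \<bullet> b) * integral {0..1} (\<lambda>t. ?f' (?s t x) b))"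
    by (rule has_integral_unique)
  then show "f x = f a + (\<Sum>b\<in>onb. ((x - a) \<bullet> b) * ?g b x)" by simp
qed

section \<open>Charts and smooth functions\<close>

lemma is_chartD:
  assumes "is_chart U \<phi>"
  shows "open U" "open (\<phi> ` U)" "continuous_on U \<phi>" "continuous_on (\<phi> ` U) (inv_into U \<phi>)"
    and "x \<in> U \<Longrightarrow> inv_into U \<phi> (\<phi> x) = x"
  using assms by (auto simp: is_chart_def homeomorphism_def)

lemma chart_inj_on: "is_chart U \<phi> \<Longrightarrow> inj_on \<phi> U"
  by (metis inj_on_def is_chartD(5))

lemma chart_inv_image:
  assumes "is_chart U \<phi>" "W \<subseteq> U"
  shows "\<phi> ` W = \<phi> ` U \<inter> inv_into U \<phi> -` W"
  using assms(2) by (force simp: is_chartD(5)[OF assms(1)])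

lemma chart_inv_preimage:
  assumes "is_chart U \<phi>" "S \<subseteq> \<phi> ` U"
  shows "inv_into U \<phi> ` S = U \<inter> \<phi> -` S"
proof (intro equalityI subsetI)
  fix x assume "x \<in> inv_into U \<phi> ` S"
  then obtain z where z: "z \<in> S" "x = inv_into U \<phi> z" by blast
  with assms(2) obtain y where "y \<in> U" "z = \<phi> y" by blast
  with z show "x \<in> U \<inter> \<phi> -` S"
    by (simp add: is_chartD(5)[OF assms(1)])
next
  fix y assume "y \<in> U \<inter> \<phi> -` S"
  then have "y \<in> U" "\<phi> y \<in> S" by auto
  then show "y \<in> inv_into U \<phi> ` S"
    by (metis is_chartD(5)[OF assms(1)] imageI)
qed

lemma chart_open_image:
  assumes "is_chart U \<phi>" "open W" "W \<subseteq> U"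
  shows "open (\<phi> ` W)"
  unfolding chart_inv_image[OF assms(1,3)]
  using continuous_on_open_vimage[OF is_chartD(2)[OF assms(1)]] is_chartD(4)[OF assms(1)] assms(2)
  by (metis Int_commute)

context smooth_manifold
begin

lemma chart_at: obtains U \<phi> where "(U, \<phi>) \<in> A" "q \<in> U"
proof -
  have "q \<in> (\<Union>(U, \<phi>)\<in>A. U)" by (simp add: cover)
  then show ?thesis using that by auto
qed

lemma smooth_funs_iff:
  "f \<in> smooth_funs A \<longleftrightarrow> (\<forall>(U, \<phi>)\<in>A. smooth_on (f \<circ> inv_into U \<phi>) (\<phi> ` U))"
proof
  assume "f \<in> smooth_funs A"
  then show "\<forall>(U, \<phi>)\<in>A. smooth_on (f \<circ> inv_into U \<phi>) (\<phi> ` U)"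
    by (auto simp: smooth_funs_def smooth_map_def)
next
  assume *: "\<forall>(U, \<phi>)\<in>A. smooth_on (f \<circ> inv_into U \<phi>) (\<phi> ` U)"
  have "isCont f q" for q
  proof -
    obtain U \<phi> where U: "(U, \<phi>) \<in> A" "q \<in> U" by (rule chart_at)
    note ch = is_chartD[OF charts[OF U(1)]]
    have "continuous_on (\<phi> ` U) (f \<circ> inv_into U \<phi>)"
      using bspec[OF * U(1)] by (intro smooth_on_continuous) (simp only: prod.case)
    then have "continuous_on U (f \<circ> inv_into U \<phi> \<circ> \<phi>)"
      using ch(3) by (rule continuous_on_compose[rotated])
    then have "continuous_on U f"
      by (rule continuous_on_eq) (simp add: ch(5))
    then show ?thesis using U(2) ch(1) by (simp add: continuous_on_eq_continuous_at)
  qed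
  with * show "f \<in> smooth_funs A"
    by (auto simp: smooth_funs_def smooth_map_def continuous_at_imp_continuous_on)
qed

lemma smooth_funsD:
  "f \<in> smooth_funs A \<Longrightarrow> (U, \<phi>) \<in> A \<Longrightarrow> smooth_on (f \<circ> inv_into U \<phi>) (\<phi> ` U)"
  using smooth_funs_iff by auto

lemma smooth_funs_const [simp]: "(\<lambda>q. c) \<in> smooth_funs A"
  unfolding smooth_funs_iff
  by (auto simp: o_def intro!: smooth_on_const dest!: charts is_chartD(2))

lemma smooth_funs_add:
  "f \<in> smooth_funs A \<Longrightarrow> g \<in> smooth_funs A \<Longrightarrow> (\<lambda>q. f q + g q) \<in> smooth_funs A"
  unfolding smooth_funs_iff
  by (fastforce simp: o_def intro!: smooth_on_add dest: charts is_chartD(2))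

lemma smooth_funs_mult:
  "f \<in> smooth_funs A \<Longrightarrow> g \<in> smooth_funs A \<Longrightarrow> (\<lambda>q. f q * g q) \<in> smooth_funs A"
  unfolding smooth_funs_iff
  by (fastforce simp: o_def intro!: smooth_on_mult dest: charts is_chartD(2))

lemma smooth_funs_sum:
  "(\<And>i. i \<in> I \<Longrightarrow> f i \<in> smooth_funs A) \<Longrightarrow> (\<lambda>q. \<Sum>i\<in>I. f i q) \<in> smooth_funs A"
  by (induction I rule: infinite_finite_induct) (auto intro: smooth_funs_add)

lemma smooth_funs_diff:
  assumes "f \<in> smooth_funs A" "g \<in> smooth_funs A"
  shows "(\<lambda>q. f q - g q) \<in> smooth_funs A"
proof -
  have "(\<lambda>q. f q + (- 1) * g q) \<in> smooth_funs A"
    using assms by (intro smooth_funs_add smooth_funs_mult smooth_funs_const)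
  then show ?thesis by simp
qed

text \<open>
  Smoothness is checked around each point: inside \<open>W\<close> the change of charts applies, and off \<open>C\<close> the function
  is zero.
\<close>

lemma smooth_fun_extend:
  assumes V: "(V, \<psi>) \<in> A" and W: "open W" "W \<subseteq> V" and C: "closed C" "C \<subseteq> W"
    and f: "smooth_on (f \<circ> inv_into V \<psi>) (\<psi> ` W)" and zero: "\<And>q. q \<notin> C \<Longrightarrow> f q = 0"
  shows "f \<in> smooth_funs A"
  unfolding smooth_funs_iff
proof (safe, rule smooth_on_local)
  fix U \<phi> y assume U: "(U, \<phi>) \<in> A" and y: "y \<in> \<phi> ` U"
  note cU = charts[OF U] and cV = charts[OF V]
  from y obtain q where q: "q \<in> U" "y = \<phi> q" by blast
  show "\<exists>T. open T \<and> y \<in> T \<and> smooth_on (f \<circ> inv_into U \<phi>) T"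
  proof (cases "q \<in> W")
    case True
    let ?T = "\<phi> ` (U \<inter> W)"
    have oT: "open ?T" using W is_chartD(1)[OF cU] by (intro chart_open_image[OF cU]) auto
    have "smooth_on (\<psi> \<circ> inv_into U \<phi>) ?T"
      using compatible[OF U V] by (rule smooth_on_subset) (use W in auto)
    then have "smooth_on (\<lambda>x. (f \<circ> inv_into V \<psi>) ((\<psi> \<circ> inv_into U \<phi>) x)) ?T"
      by (rule smooth_on_compose[OF _ f oT chart_open_image[OF cV W]])
         (auto simp: is_chartD(5)[OF cU])
    then have "smooth_on (f \<circ> inv_into U \<phi>) ?T"
      by (rule smooth_on_cong[OF _ oT])
         (use W in \<open>auto simp: is_chartD(5)[OF cU] is_chartD(5)[OF cV]\<close>)
    with oT True q show ?thesis by blast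
  next
    case False
    let ?T = "\<phi> ` (U - C)"
    have oT: "open ?T" using C is_chartD(1)[OF cU] by (intro chart_open_image[OF cU]) auto
    have "smooth_on (f \<circ> inv_into U \<phi>) ?T"
      by (rule smooth_on_cong[OF smooth_on_const[OF oT, of 0] oT])
         (auto simp: is_chartD(5)[OF cU] zero)
    with oT False C q show ?thesis by blast
  qed
qed

text \<open>The arbitrary values of \<open>\<psi>\<close> outside \<open>V\<close> are harmless since \<open>\<rho>\<close> vanishes there.\<close>

lemma smooth_fun_cutoff:
  assumes V: "(V, \<psi>) \<in> A" and W: "open W" "W \<subseteq> V" and C: "closed C" "C \<subseteq> W"
    and \<rho>: "\<rho> \<in> smooth_funs A" "\<And>q. q \<notin> C \<Longrightarrow> \<rho> q = 0" and k: "smooth_on k (\<psi> ` W)"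
  shows "(\<lambda>q. \<rho> q * k (\<psi> q)) \<in> smooth_funs A"
proof (rule smooth_fun_extend[OF V W C])
  note cV = charts[OF V]
  have oW: "open (\<psi> ` W)" by (rule chart_open_image[OF cV W])
  have "smooth_on (\<lambda>x. (\<rho> \<circ> inv_into V \<psi>) x * k x) (\<psi> ` W)"
    using W(2) by (intro smooth_on_mult k oW smooth_on_subset[OF smooth_funsD[OF \<rho>(1) V]] image_mono)
  then show "smooth_on ((\<lambda>q. \<rho> q * k (\<psi> q)) \<circ> inv_into V \<psi>) (\<psi> ` W)"
    by (rule smooth_on_cong[OF _ oW]) (use W in \<open>auto simp: is_chartD(5)[OF cV]\<close>)
qed (use \<rho>(2) in auto)

text \<open>
  In a chart, this is the plateau function composed with \<open>2 |x - a|^2 / e^2 - 1\<close>: the value is one for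
  \<open>|x - a| \<le> e / 2\<close> and zero for \<open>|x - a| \<ge> e\<close>.
\<close>

lemma bump:
  assumes W: "open W" "q \<in> W"
  obtains \<rho> N C where "\<rho> \<in> smooth_funs A" "open N" "q \<in> N" "\<And>y. y \<in> N \<Longrightarrow> \<rho> y = 1"
    "compact C" "C \<subseteq> W" "\<And>y. y \<notin> C \<Longrightarrow> \<rho> y = 0"
proof -
  obtain U \<phi> where U: "(U, \<phi>) \<in> A" "q \<in> U" by (rule chart_at)
  note cU = charts[OF U(1)]
  note ch = is_chartD[OF cU]
  let ?V = "\<phi> ` (U \<inter> W)" and ?a = "\<phi> q" and ?i = "inv_into U \<phi>"
  have oV: "open ?V" using W ch(1) by (intro chart_open_image[OF cU]) auto
  moreover have "?a \<in> ?V" using U W by auto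
  ultimately obtain e where e: "e > 0" "cball ?a e \<subseteq> ?V" by (meson open_contains_cball)
  obtain h :: "real \<Rightarrow> real" where h: "smooth_on h UNIV"
    "\<And>t. t \<le> 0 \<Longrightarrow> h t = 1" "\<And>t. t \<ge> 1 \<Longrightarrow> h t = 0"
    using plateau by blast
  \<comment> \<open>the squared norm is written in coordinates so that smoothness is visible\<close>
  define r where "r x = 2 / e\<^sup>2 * (\<Sum>b\<in>onb. ((x - ?a) \<bullet> b) * ((x - ?a) \<bullet> b)) + (- 1)" for x
  have r: "r x = 2 / e\<^sup>2 * (norm (x - ?a))\<^sup>2 - 1" for x
  proof -
    have "(norm (x - ?a))\<^sup>2 = (x - ?a) \<bullet> (\<Sum>b\<in>onb. ((x - ?a) \<bullet> b) *\<^sub>R b)"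
      using onb_expansion[of "x - ?a"] by (simp add: power2_norm_eq_inner)
    then show ?thesis by (simp add: r_def inner_sum_right)
  qed
  have "smooth_on (\<lambda>x. (x - ?a) \<bullet> b) UNIV" for b
    using smooth_on_add[OF smooth_on_linear[OF bounded_linear_inner_left, of UNIV b]
        smooth_on_const[of UNIV "- (?a \<bullet> b)"]] by (simp add: inner_diff_left)
  then have "smooth_on r UNIV" unfolding r_def
    by (intro smooth_on_add smooth_on_mult smooth_on_sum smooth_on_const) auto
  then have hr: "smooth_on (\<lambda>x. h (r x)) UNIV" by (rule smooth_on_compose[OF _ h(1)]) auto
  define C where "C = ?i ` cball ?a e"
  define N where "N = ?i ` ball ?a (e / 2)"
  have bV: "ball ?a (e/2) \<subseteq> ?V" using e by (auto simp: subset_iff)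
  have C: "compact C" unfolding C_def
    by (intro compact_continuous_image compact_cball continuous_on_subset[OF ch(4)]) (use e in auto)
  have CW: "C \<subseteq> U \<inter> W" unfolding C_def using e(2) by (force simp: ch(5))
  have C_iff: "y \<in> C \<longleftrightarrow> \<phi> y \<in> cball ?a e" if "y \<in> U" for y
    using that e(2) unfolding C_def by (subst chart_inv_preimage[OF cU]) blast+
  have N_eq: "N = U \<inter> \<phi> -` ball ?a (e / 2)"
    using bV unfolding N_def by (intro chart_inv_preimage[OF cU]) blast
  then have oN: "open N"
    using continuous_on_open_vimage[OF ch(1), of \<phi>] ch(3) by (auto simp: N_eq Int_commute)
  have NU: "N \<subseteq> U" using N_eq by auto
  define \<rho> where "\<rho> y = (if y \<in> C then h (r (\<phi> y)) else 0)" for y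
  have one: "\<rho> y = 1" if "y \<in> N" for y
  proof -
    have d: "norm (\<phi> y - ?a) \<le> e / 2"
      using that N_eq by (auto simp: dist_norm norm_minus_commute)
    then have "(norm (\<phi> y - ?a))\<^sup>2 \<le> (e / 2)\<^sup>2" by (intro power_mono) auto
    then have "4 * (norm (\<phi> y - ?a))\<^sup>2 \<le> e\<^sup>2" by (simp add: power_divide)
    then have "2 * (norm (\<phi> y - ?a))\<^sup>2 \<le> e\<^sup>2"
      using zero_le_power2[of "norm (\<phi> y - ?a)"] by linarith
    then have "r (\<phi> y) \<le> 0" using e(1) by (simp add: r field_simps)
    moreover have "y \<in> C" using d that NU e(1) by (subst C_iff) (auto simp: dist_norm norm_minus_commute)
    ultimately show ?thesis by (simp add: \<rho>_def h(2))
  qed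
  have eq: "\<rho> y = h (r (\<phi> y))" if "y \<in> U" for y
  proof (cases "y \<in> C")
    case False
    then have "e \<le> norm (\<phi> y - ?a)" using C_iff[OF that] by (simp add: dist_norm norm_minus_commute)
    then have "e\<^sup>2 \<le> (norm (\<phi> y - ?a))\<^sup>2" using e(1) by (intro power_mono) auto
    then have "r (\<phi> y) \<ge> 1" using e(1) by (simp add: r field_simps)
    then show ?thesis using False by (simp add: \<rho>_def h(3))
  qed (simp add: \<rho>_def)
  have "smooth_on (\<rho> \<circ> ?i) (\<phi> ` U)"
    by (rule smooth_on_cong[OF smooth_on_subset[OF hr] ch(2)]) (auto simp: ch(5) eq)
  then have "\<rho> \<in> smooth_funs A"
    using CW by (intro smooth_fun_extend[OF U(1) ch(1) subset_refl compact_imp_closed[OF C]])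
      (auto simp: \<rho>_def)
  moreover have "q \<in> N" using N_eq U e(1) by auto
  ultimately show thesis using that[of \<rho> N C] oN one C CW by (auto simp: \<rho>_def)
qed


subsection \<open>Tangent vectors\<close>

lemma tangentD:
  assumes "D \<in> tangent_space A q"
  shows "f \<notin> smooth_funs A \<Longrightarrow> D f = 0"
    and "f \<in> smooth_funs A \<Longrightarrow> g \<in> smooth_funs A \<Longrightarrow> D (\<lambda>x. f x + g x) = D f + D g"
    and "f \<in> smooth_funs A \<Longrightarrow> D (\<lambda>x. c * f x) = c * D f"
    and "f \<in> smooth_funs A \<Longrightarrow> g \<in> smooth_funs A \<Longrightarrow> D (\<lambda>x. f x * g x) = f q * D g + g q * D f"
  using assms by (auto simp: tangent_space_def)

lemma tangent_const:
  assumes "D \<in> tangent_space A q"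
  shows "D (\<lambda>x. c) = 0"
  using tangentD(4)[OF assms smooth_funs_const smooth_funs_const, of 1 1]
    tangentD(3)[OF assms smooth_funs_const, of c 1] by simp

lemma tangent_diff:
  assumes "D \<in> tangent_space A q" "f \<in> smooth_funs A" "g \<in> smooth_funs A"
  shows "D (\<lambda>x. f x - g x) = D f - D g"
  using tangentD(2)[OF assms(1,2) smooth_funs_mult[OF smooth_funs_const assms(3), of "-1"]]
    tangentD(3)[OF assms(1,3), of "-1"] by simp

lemma tangent_sum:
  assumes D: "D \<in> tangent_space A q" and f: "\<And>i. i \<in> I \<Longrightarrow> f i \<in> smooth_funs A"
  shows "D (\<lambda>x. \<Sum>i\<in>I. f i x) = (\<Sum>i\<in>I. D (f i))"
  using f
proof (induction I rule: infinite_finite_induct)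
  case (insert i I)
  then show ?case using tangentD(2)[OF D, of "f i" "\<lambda>x. \<Sum>i\<in>I. f i x"]
    by (simp add: smooth_funs_sum)
qed (simp_all add: tangent_const[OF D])

text \<open>
  If \<open>\<rho>\<close> is a bump function supported in \<open>N\<close>, then \<open>\<rho> (f - g)\<close> is zero, and the product rule at \<open>q\<close> returns
  \<open>D (f - g)\<close>.
\<close>

lemma tangent_local:
  assumes D: "D \<in> tangent_space A q" and fg: "f \<in> smooth_funs A" "g \<in> smooth_funs A"
    and N: "open N" "q \<in> N" "\<And>y. y \<in> N \<Longrightarrow> f y = g y"
  shows "D f = D g"
proof -
  obtain \<rho> M C where \<rho>: "\<rho> \<in> smooth_funs A" "q \<in> M" "\<And>y. y \<in> M \<Longrightarrow> \<rho> y = 1"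
    "C \<subseteq> N" "\<And>y. y \<notin> C \<Longrightarrow> \<rho> y = 0"
    by (rule bump[OF N(1,2)]) blast
  have "(\<lambda>y. \<rho> y * (f y - g y)) = (\<lambda>y. 0)" using \<rho>(4,5) N(3) by fastforce
  then have "\<rho> q * D (\<lambda>y. f y - g y) + (f q - g q) * D \<rho> = 0"
    using tangentD(4)[OF D \<rho>(1) smooth_funs_diff[OF fg]] tangent_const[OF D] by simp
  then show ?thesis using \<rho>(2,3) N(2,3) tangent_diff[OF D fg] by simp
qed

text \<open>
  By Hadamard's lemma, \<open>f - f(q)\<close> is near \<open>q\<close> a sum of products \<open>x\<^sub>b g\<^sub>b\<close>, where \<open>x\<^sub>b\<close> vanishes at \<open>q\<close> as a centred
  coordinate and \<open>g\<^sub>b\<close> does because its value is a partial derivative of \<open>f\<close>. A derivation at \<open>q\<close> kills such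
  products. Bump functions make both factors global.
\<close>

lemma tangent_critical:
  assumes D: "D \<in> tangent_space A q" and U: "(U, \<phi>) \<in> A" "q \<in> U" and f: "f \<in> smooth_funs A"
    and crit: "((f \<circ> inv_into U \<phi>) has_derivative (\<lambda>v. 0)) (at (\<phi> q))"
  shows "D f = 0"
proof -
  note cU = charts[OF U(1)]
  note ch = is_chartD[OF cU]
  let ?a = "\<phi> q" and ?i = "inv_into U \<phi>"
  obtain r where r: "r > 0" "ball ?a r \<subseteq> \<phi> ` U"
    using openE[OF ch(2), of ?a] U(2) by blast
  define W where "W = U \<inter> \<phi> -` ball ?a r"
  have W: "open W" "q \<in> W" "W \<subseteq> U" "\<phi> ` W \<subseteq> ball ?a r"
    using continuous_on_open_vimage[OF ch(1)] ch(3) r(1) U(2) unfolding W_def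
    by (auto simp: Int_commute)
  obtain g where g: "\<And>b. smooth_on (g b) (ball ?a r)"
      "\<And>b. g b ?a = frechet_derivative (f \<circ> ?i) (at ?a) b"
      "\<And>x. x \<in> ball ?a r \<Longrightarrow> (f \<circ> ?i) x = (f \<circ> ?i) ?a + (\<Sum>b\<in>onb. ((x - ?a) \<bullet> b) * g b x)"
    by (rule hadamard[OF smooth_on_subset[OF smooth_funsD[OF f U(1)] r(2)]]) blast
  have g0: "g b ?a = 0" for b using g(2) frechet_derivative_at[OF crit] by metis
  obtain \<rho> N C where \<rho>: "\<rho> \<in> smooth_funs A" "open N" "q \<in> N" "\<And>y. y \<in> N \<Longrightarrow> \<rho> y = 1"
    "compact C" "C \<subseteq> W" "\<And>y. y \<notin> C \<Longrightarrow> \<rho> y = 0"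
    by (rule bump[OF W(1,2)]) blast
  note cut = smooth_fun_cutoff[OF U(1) W(1,3) compact_imp_closed[OF \<rho>(5)] \<rho>(6,1,7)]
  define x where "x b y = \<rho> y * ((\<phi> y - ?a) \<bullet> b)" for b y
  define G where "G b y = \<rho> y * g b (\<phi> y)" for b y
  have oW: "open (\<phi> ` W)" by (rule chart_open_image[OF cU W(1,3)])
  have x: "x b \<in> smooth_funs A" for b
  proof -
    have "smooth_on (\<lambda>z. (z \<bullet> b) + (- (?a \<bullet> b))) (\<phi> ` W)"
      by (intro smooth_on_add smooth_on_linear smooth_on_const bounded_linear_inner_left oW)
    then have "smooth_on (\<lambda>z. (z - ?a) \<bullet> b) (\<phi> ` W)" by (simp add: inner_diff_left)
    then show ?thesis unfolding x_def using cut[of "\<lambda>z. (z - ?a) \<bullet> b"] by simp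
  qed
  have G: "G b \<in> smooth_funs A" for b
    unfolding G_def by (intro cut smooth_on_subset[OF g(1)] W(4))
  have "D f = D (\<lambda>y. f q + (\<Sum>b\<in>onb. x b y * G b y))"
  proof (rule tangent_local[OF D f])
    show "(\<lambda>y. f q + (\<Sum>b\<in>onb. x b y * G b y)) \<in> smooth_funs A"
      by (intro smooth_funs_add smooth_funs_sum smooth_funs_mult x G smooth_funs_const)
    show "open (N \<inter> W)" "q \<in> N \<inter> W" using \<rho>(2,3) W by auto
    fix y assume y: "y \<in> N \<inter> W"
    then have "\<phi> y \<in> ball ?a r" "y \<in> U" using W by auto
    from g(3)[OF this(1)] this(2) U(2) y show "f y = f q + (\<Sum>b\<in>onb. x b y * G b y)"
      by (simp add: x_def G_def \<rho>(4) ch(5))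
  qed
  also have "\<dots> = (\<Sum>b\<in>onb. x b q * D (G b) + G b q * D (x b))"
    by (simp add: tangentD(2)[OF D] tangentD(4)[OF D x G] tangent_const[OF D] tangent_sum[OF D]
        smooth_funs_sum smooth_funs_mult x G)
  also have "\<dots> = 0" by (simp add: x_def G_def g0)
  finally show ?thesis .
qed

text \<open>
  The function \<open>f\<close> minus its linear part in the cut-off coordinates \<open>\<rho> (\<phi> \<bullet> b)\<close> has a critical point at \<open>q\<close>.
  Consequently a tangent vector is determined by its values on these finitely many coordinates.
\<close>

lemma tangent_expand:
  assumes D: "D \<in> tangent_space A q" and U: "(U, \<phi>) \<in> A" and f: "f \<in> smooth_funs A"
    and \<rho>: "\<rho> \<in> smooth_funs A" "open N" "q \<in> N" "\<And>y. y \<in> N \<Longrightarrow> \<rho> y = 1"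
    and C: "compact C" "C \<subseteq> U" "\<And>y. y \<notin> C \<Longrightarrow> \<rho> y = 0"
  shows "D f = (\<Sum>b\<in>onb. D (\<lambda>y. \<rho> y * (\<phi> y \<bullet> b)) * frechet_derivative (f \<circ> inv_into U \<phi>) (at (\<phi> q)) b)"
proof -
  note cU = charts[OF U]
  note ch = is_chartD[OF cU]
  let ?i = "inv_into U \<phi>"
  have NU: "N \<subseteq> U" using \<rho>(4) C(2,3) by (metis subset_iff zero_neq_one)
  then have qU: "q \<in> U" using \<rho>(3) by blast
  let ?f' = "frechet_derivative (f \<circ> ?i) (at (\<phi> q))"
  define x where "x b y = \<rho> y * (\<phi> y \<bullet> b)" for b y
  have x: "x b \<in> smooth_funs A" for b
    unfolding x_def
    by (intro smooth_fun_cutoff[OF U ch(1) subset_refl compact_imp_closed[OF C(1)] C(2) \<rho>(1) C(3)]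
        smooth_on_linear bounded_linear_inner_left ch(2))
  define s where "s y = (\<Sum>b\<in>onb. ?f' b * x b y)" for y
  have s: "s \<in> smooth_funs A"
    unfolding s_def by (intro smooth_funs_sum smooth_funs_mult smooth_funs_const x)
  have df: "((f \<circ> ?i) has_derivative ?f') (at (\<phi> q))"
    using smooth_on_has_derivative[OF smooth_funsD[OF f U]] qU by blast
  have "((\<lambda>z. \<Sum>b\<in>onb. ?f' b * (z \<bullet> b)) has_derivative (\<lambda>v. \<Sum>b\<in>onb. ?f' b * (v \<bullet> b))) (at (\<phi> q))"
    by (intro derivative_intros)
  moreover have "(\<lambda>v. \<Sum>b\<in>onb. ?f' b * (v \<bullet> b)) = ?f'"
    using linear_onb_expansion[OF has_derivative_linear[OF df], symmetric]
    by (intro ext) (simp add: mult.commute)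
  ultimately have "((\<lambda>z. \<Sum>b\<in>onb. ?f' b * (z \<bullet> b)) has_derivative ?f') (at (\<phi> q))"
    by (simp only:)
  then have "((s \<circ> ?i) has_derivative ?f') (at (\<phi> q))"
    by (rule has_derivative_transform_within_open[OF _ chart_open_image[OF cU \<rho>(2) NU]])
       (use \<rho>(3) NU in \<open>auto simp: s_def x_def ch(5) \<rho>(4) subset_iff\<close>)
  from has_derivative_diff[OF df this]
  have "(((\<lambda>y. f y - s y) \<circ> ?i) has_derivative (\<lambda>v. 0)) (at (\<phi> q))"
    by (simp add: o_def)
  from tangent_critical[OF D U qU smooth_funs_diff[OF f s] this]
  have "D f = D s" by (simp add: tangent_diff[OF D f s])
  also have "\<dots> = (\<Sum>b\<in>onb. D (x b) * ?f' b)"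
    unfolding s_def
    by (simp add: tangent_sum[OF D] tangentD(3)[OF D x] smooth_funs_mult x)
       (simp add: mult.commute)
  finally show ?thesis by (simp add: x_def[abs_def])
qed

end

section \<open>Derivations and subspaces of finite codimension\<close>

text \<open>
  Induction on the number of conditions: of two solutions \<open>p\<close> and \<open>q\<close>, the second divisible by a higher power
  than the degree of \<open>p\<close>, a nontrivial combination meets one more condition, and it is nonzero by comparison of
  degrees. The exponent \<open>n\<close> is what makes the induction work.
\<close>

lemma poly_annihilator:
  fixes l :: "'i \<Rightarrow> real poly \<Rightarrow> real"
  assumes "finite I" and "\<And>i p q. i \<in> I \<Longrightarrow> l i (p + q) = l i p + l i q"
    and "\<And>i c p. i \<in> I \<Longrightarrow> l i (smult c p) = c * l i p"
  shows "\<exists>p. p \<noteq> 0 \<and> monom 1 n dvd p \<and> (\<forall>i\<in>I. l i p = 0)"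
  using assms
proof (induction I arbitrary: n)
  case empty
  show ?case by (intro exI[of _ "monom 1 n"]) auto
next
  case (insert j I)
  then have IH: "\<exists>p. p \<noteq> 0 \<and> monom 1 n dvd p \<and> (\<forall>i\<in>I. l i p = 0)" for n by simp
  obtain p where p: "p \<noteq> 0" "monom 1 n dvd p" "\<forall>i\<in>I. l i p = 0" using IH by blast
  obtain q where q: "q \<noteq> 0" "monom 1 (Suc (degree p) + n) dvd q" "\<forall>i\<in>I. l i q = 0"
    using IH by blast
  have qn: "monom 1 n dvd q"
  proof -
    have "monom 1 (Suc (degree p) + n) = monom 1 n * monom (1::real) (Suc (degree p))"
      by (simp add: mult_monom add.commute)
    then show ?thesis using q(2) by (metis dvd_mult_left)
  qed
  show ?case
  proof (cases "l j p = 0")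
    case True then show ?thesis using p by auto
  next
    case False
    let ?r = "smult (l j p) q + smult (- l j q) p"
    have "?r \<noteq> 0"
    proof
      assume r: "?r = 0"
      have "degree (smult (l j p) q) \<ge> Suc (degree p)"
        using dvd_imp_degree_le[OF q(2)] q(1) False by (simp add: degree_monom_eq)
      moreover have "degree (smult (- l j q) p) \<le> degree p" by (rule degree_smult_le)
      moreover have "smult (l j p) q = - smult (- l j q) p" using r by (simp add: eq_neg_iff_add_eq_0)
      ultimately show False by (metis degree_minus not_less_eq_eq order_trans)
    qed
    moreover have "monom 1 n dvd ?r" using p(2) qn by (intro dvd_add dvd_smult)
    moreover have "l i ?r = 0" if "i \<in> insert j I" for i
      using that p(3) q(3) by (auto simp only: insert.prems) auto
    ultimately show ?thesis by blast
  qed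
qed

text \<open>
  The situation of a single vector field \<open>X\<close>, where \<open>f \<in> A\<close> stands for the field \<open>f X\<close>: the bracket of \<open>f X\<close>
  and \<open>g X\<close> is \<open>(f X(g) - g X(f)) X\<close>, so brackets become an operation on functions.
\<close>

locale function_derivation =
  fixes A :: "('m \<Rightarrow> real) set" and X :: "('m \<Rightarrow> real) \<Rightarrow> 'm \<Rightarrow> real"
  assumes A_const: "(\<lambda>q. c) \<in> A"
    and A_add: "f \<in> A \<Longrightarrow> g \<in> A \<Longrightarrow> (\<lambda>q. f q + g q) \<in> A"
    and A_mult: "f \<in> A \<Longrightarrow> g \<in> A \<Longrightarrow> (\<lambda>q. f q * g q) \<in> A"
    and X_closed: "f \<in> A \<Longrightarrow> X f \<in> A"
    and X_add: "f \<in> A \<Longrightarrow> g \<in> A \<Longrightarrow> X (\<lambda>q. f q + g q) = (\<lambda>q. X f q + X g q)"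
    and X_mult: "f \<in> A \<Longrightarrow> g \<in> A \<Longrightarrow> X (\<lambda>q. f q * g q) = (\<lambda>q. f q * X g q + g q * X f q)"
    and X_const: "X (\<lambda>q. c) = (\<lambda>q. 0)"
begin

lemma A_poly: "y \<in> A \<Longrightarrow> (\<lambda>q. poly p (y q)) \<in> A"
  by (induction p) (auto intro: A_const A_add A_mult)

lemma X_poly:
  assumes "y \<in> A"
  shows "X (\<lambda>q. poly p (y q)) = (\<lambda>q. poly (pderiv p) (y q) * X y q)"
proof (induction p)
  case 0
  then show ?case by (simp add: X_const)
next
  case (pCons a p)
  have "X (\<lambda>q. a + y q * poly p (y q)) = (\<lambda>q. y q * X (\<lambda>q. poly p (y q)) q + poly p (y q) * X y q)"
    by (subst X_add) (auto simp: X_const X_mult[OF assms A_poly[OF assms]]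
        intro: A_const A_mult[OF assms A_poly[OF assms]])
  then show ?case by (simp add: pCons.IH pderiv_pCons algebra_simps)
qed

text \<open>
  Here \<open>F\<close> is an ideal for the bracket of functions just described, and \<open>H\<close> consists of functions supported where
  \<open>X(y) = 1\<close>. Let \<open>f = p(y) \<in> F\<close>. Bracketing \<open>f\<close> with \<open>f g\<close> gives \<open>f^2 X(g) \<in> F\<close> for every \<open>g\<close>, because the terms
  without a derivative of \<open>g\<close> cancel. Bracketing \<open>f^2 X(y)\<close> with \<open>h \<in> H\<close> then gives \<open>f^2 X(h) - 2 h f X(f)\<close>, whence
  \<open>h f X(f) = h (p p')(y) \<in> F\<close>. So \<open>F\<close> contains all \<open>h r(y)\<close> for one polynomial \<open>r = p p'\<close>, which is nonzero because
  \<open>p\<close> is not constant. Bracketing with the constant \<open>1\<close> replaces \<open>r\<close> by \<open>r'\<close>, until a nonzero constant is reached.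
\<close>

lemma derivative_ideal_subset:
  assumes F_sub: "F \<subseteq> A"
    and F_add: "\<And>f g. f \<in> F \<Longrightarrow> g \<in> F \<Longrightarrow> (\<lambda>q. f q + g q) \<in> F"
    and F_scale: "\<And>c f. f \<in> F \<Longrightarrow> (\<lambda>q. c * f q) \<in> F"
    and F_bracket: "\<And>f g. f \<in> F \<Longrightarrow> g \<in> A \<Longrightarrow> (\<lambda>q. f q * X g q - g q * X f q) \<in> F"
    and y: "y \<in> A"
    and codim: "p \<noteq> 0" "poly p 0 = 0" "(\<lambda>q. poly p (y q)) \<in> F"
    and H_sub: "H \<subseteq> A"
    and H_mult: "\<And>h f. h \<in> H \<Longrightarrow> f \<in> A \<Longrightarrow> (\<lambda>q. h q * f q) \<in> H"
    and H_X: "\<And>h. h \<in> H \<Longrightarrow> X h \<in> H"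
    and H_y: "\<And>h q. h \<in> H \<Longrightarrow> h q * X y q = h q"
  shows "H \<subseteq> F"
proof -
  define f where "f q = poly p (y q)" for q
  have fF: "f \<in> F" using codim(3) by (simp add: f_def[abs_def])
  have fA: "f \<in> A" using fF F_sub by blast
  have Xf: "X f q = poly (pderiv p) (y q) * X y q" for q
    using X_poly[OF y, of p] by (simp add: f_def[abs_def])
  have F_diff: "(\<lambda>q. g q - h q) \<in> F" if "g \<in> F" "h \<in> F" for g h
    using F_add[OF that(1) F_scale[OF that(2), of "-1"]] by simp
  have square: "(\<lambda>q. f q * f q * X g q) \<in> F" if g: "g \<in> A" for g
    using F_bracket[OF fF A_mult[OF fA g]] by (simp add: X_mult[OF fA g] algebra_simps)
  \<comment> \<open>apply \<open>X\<close> to \<open>h X(y) = h\<close>\<close>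
  have Xy2: "h q * X (X y) q = 0" if h: "h \<in> H" for h q
  proof -
    have hA: "h \<in> A" using h H_sub by blast
    have "X (\<lambda>q. h q * X y q) = X h" by (simp only: H_y[OF h])
    then have "h q * X (X y) q + X y q * X h q = X h q"
      by (simp add: X_mult[OF hA X_closed[OF y]] fun_eq_iff)
    then show ?thesis using H_y[OF H_X[OF h], of q] by (simp add: mult.commute)
  qed
  have start: "(\<lambda>q. h q * poly (p * pderiv p) (y q)) \<in> F" if h: "h \<in> H" for h
  proof -
    have hA: "h \<in> A" using h H_sub by blast
    have ffA: "(\<lambda>q. f q * f q) \<in> A" by (intro A_mult fA)
    have "X (\<lambda>q. (f q * f q) * X y q) =
        (\<lambda>q. f q * f q * X (X y) q + X y q * (f q * X f q + f q * X f q))"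
      by (simp add: X_mult[OF ffA X_closed[OF y]] X_mult[OF fA fA])
    then have "(\<lambda>q. f q * f q * X y q * X h q -
        h q * (f q * f q * X (X y) q + X y q * (f q * X f q + f q * X f q))) \<in> F"
      using F_bracket[OF square[OF y] hA] by simp
    moreover have "f q * f q * X y q * X h q -
        h q * (f q * f q * X (X y) q + X y q * (f q * X f q + f q * X f q)) =
        f q * f q * X h q - 2 * (h q * poly (p * pderiv p) (y q))" for q
    proof -
      have e1: "f q * f q * X y q * X h q = f q * f q * X h q"
        using H_y[OF H_X[OF h], of q] by (simp add: mult.commute mult.left_commute)
      have "h q * (f q * f q * X (X y) q + X y q * (f q * X f q + f q * X f q)) =
          f q * f q * (h q * X (X y) q) + 2 * f q * (poly (pderiv p) (y q) * ((h q * X y q) * X y q))"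
        by (simp add: Xf algebra_simps)
      also have "\<dots> = 2 * (h q * poly (p * pderiv p) (y q))"
        by (simp only: Xy2[OF h] H_y[OF h]) (simp add: f_def)
      finally show ?thesis by (simp only: e1)
    qed
    ultimately have "(\<lambda>q. f q * f q * X h q - 2 * (h q * poly (p * pderiv p) (y q))) \<in> F" by simp
    from F_scale[OF F_diff[OF square[OF hA] this], of "1/2"] show ?thesis by simp
  qed
  \<comment> \<open>the bracket with \<open>1\<close> also yields \<open>X(h) r(y)\<close>, which lies in \<open>F\<close> by the hypothesis on \<open>r\<close>\<close>
  have step: "(\<lambda>q. h q * poly (pderiv r) (y q)) \<in> F"
    if r: "\<And>h. h \<in> H \<Longrightarrow> (\<lambda>q. h q * poly r (y q)) \<in> F" and h: "h \<in> H" for r h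
  proof -
    have hA: "h \<in> A" using h H_sub by blast
    have "(\<lambda>q. 0 - X (\<lambda>q. h q * poly r (y q)) q) \<in> F"
      using F_bracket[OF r[OF h] A_const[of 1]] by (simp add: X_const)
    moreover have "X (\<lambda>q. h q * poly r (y q)) q = h q * poly (pderiv r) (y q) + X h q * poly r (y q)" for q
    proof -
      have "X (\<lambda>q. h q * poly r (y q)) q = poly (pderiv r) (y q) * (h q * X y q) + poly r (y q) * X h q"
        by (simp add: X_mult[OF hA A_poly[OF y]] X_poly[OF y] ac_simps)
      then show ?thesis by (simp add: H_y[OF h] mult.commute)
    qed
    ultimately have "(\<lambda>q. 0 - (h q * poly (pderiv r) (y q) + X h q * poly r (y q))) \<in> F" by simp
    from F_scale[OF F_add[OF this r[OF H_X[OF h]]], of "-1"] show ?thesis by simp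
  qed
  have iter: "(\<lambda>q. h q * poly ((pderiv ^^ n) (p * pderiv p)) (y q)) \<in> F" if "h \<in> H" for h n
    using that
  proof (induction n arbitrary: h)
    case 0 then show ?case using start by simp
  next
    case (Suc n) then show ?case using step[OF Suc.IH] by simp
  qed
  have "pderiv p \<noteq> 0"
  proof
    assume "pderiv p = 0"
    then obtain c where "p = [:c:]" using pderiv_eq_0_iff degree_eq_zeroE by metis
    then show False using codim by simp
  qed
  then have "p * pderiv p \<noteq> 0" using codim(1) by simp
  moreover have "\<exists>n c. c \<noteq> 0 \<and> (pderiv ^^ n) r = [:c:]" if "r \<noteq> 0" for r :: "real poly"
    using that
  proof (induction "degree r" arbitrary: r)
    case 0
    then obtain c where "r = [:c:]" "c \<noteq> 0" by (metis degree_eq_zeroE pCons_0_0)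
    then show ?case by (intro exI[of _ 0] exI[of _ c]) simp
  next
    case (Suc n)
    have "degree (pderiv r) = n" using Suc(2) by (simp add: degree_pderiv)
    moreover have "pderiv r \<noteq> 0" using Suc(2) by (simp add: pderiv_eq_0_iff)
    ultimately obtain m c where "c \<noteq> 0" "(pderiv ^^ m) (pderiv r) = [:c:]" using Suc(1) by blast
    then show ?case by (intro exI[of _ "Suc m"] exI[of _ c]) (simp add: funpow_swap1)
  qed
  ultimately obtain n c where c: "c \<noteq> 0" "(pderiv ^^ n) (p * pderiv p) = [:c:]" by blast
  show "H \<subseteq> F"
  proof
    fix h assume "h \<in> H"
    from F_scale[OF iter[OF this, of n], of "1 / c"] c show "h \<in> F" by simp
  qed
qed

end

section \<open>Vector fields\<close>

definition vf_mult :: "('m \<Rightarrow> real) \<Rightarrow> 'm vfield \<Rightarrow> 'm vfield" where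
  "vf_mult f X = (\<lambda>q g. f q * X q g)"

lemma vf_supp_mult: "vf_supp (vf_mult f X) \<subseteq> vf_supp X"
  unfolding vf_supp_def by (intro closure_mono) (auto simp: vf_mult_def)

lemma vf_supp_add: "vf_supp (vf_add X Y) \<subseteq> vf_supp X \<union> vf_supp Y"
  unfolding vf_supp_def closure_Un[symmetric] by (intro closure_mono) (auto simp: vf_add_def)

lemma vf_zero_off_supp: "q \<notin> vf_supp X \<Longrightarrow> X q = (\<lambda>f. 0)"
  unfolding vf_supp_def using closure_subset[of "{q. X q \<noteq> (\<lambda>f. 0)}"] by blast

lemma compact_vf_supp_subset: "compact K \<Longrightarrow> vf_supp X \<subseteq> K \<Longrightarrow> compact (vf_supp X)"
  using compact_Int_closed[of K "vf_supp X"] by (simp add: vf_supp_def Int_absorb1)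

context smooth_manifold
begin

lemma vector_fieldsD:
  assumes "X \<in> vector_fields A"
  shows "X q \<in> tangent_space A q" and "f \<in> smooth_funs A \<Longrightarrow> (\<lambda>q. X q f) \<in> smooth_funs A"
  using assms by (auto simp: vector_fields_def)

lemma vf_mult_closed:
  assumes "f \<in> smooth_funs A" "X \<in> vector_fields A"
  shows "vf_mult f X \<in> vector_fields A"
  unfolding vector_fields_def vf_mult_def
proof (intro CollectI conjI allI ballI)
  fix q
  note D = vector_fieldsD(1)[OF assms(2), of q]
  show "(\<lambda>g. f q * X q g) \<in> tangent_space A q"
    unfolding tangent_space_def
    using tangentD(1)[OF D]
    by (simp add: tangentD(2-4)[OF D] tangent_const[OF D] distrib_left mult.left_commute)
next
  fix g assume "g \<in> smooth_funs A"
  then show "(\<lambda>q. f q * X q g) \<in> smooth_funs A"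
    by (intro smooth_funs_mult assms(1) vector_fieldsD(2)[OF assms(2)])
qed

lemma vf_add_closed:
  assumes "X \<in> vector_fields A" "Y \<in> vector_fields A"
  shows "vf_add X Y \<in> vector_fields A"
  unfolding vector_fields_def vf_add_def
proof (intro CollectI conjI allI ballI)
  fix q
  note D = vector_fieldsD(1)[OF assms(1), of q] and E = vector_fieldsD(1)[OF assms(2), of q]
  show "(\<lambda>f. X q f + Y q f) \<in> tangent_space A q"
    unfolding tangent_space_def
    using tangentD(1)[OF D] tangentD(1)[OF E]
    by (simp add: tangentD(2-4)[OF D] tangentD(2-4)[OF E] tangent_const[OF D] tangent_const[OF E]
        distrib_left)
next
  fix g assume "g \<in> smooth_funs A"
  then show "(\<lambda>q. X q g + Y q g) \<in> smooth_funs A"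
    by (intro smooth_funs_add vector_fieldsD(2)[OF assms(1)] vector_fieldsD(2)[OF assms(2)])
qed

lemma vf_bracket_mult:
  assumes X: "X \<in> vector_fields A" and f: "f \<in> smooth_funs A" and g: "g \<in> smooth_funs A"
  shows "vf_bracket (vf_mult f X) (vf_mult g X) = vf_mult (\<lambda>q. f q * X q g - g q * X q f) X"
proof (intro ext)
  fix q h
  note D = vector_fieldsD(1)[OF X]
  show "vf_bracket (vf_mult f X) (vf_mult g X) q h = vf_mult (\<lambda>q. f q * X q g - g q * X q f) X q h"
  proof (cases "h \<in> smooth_funs A")
    case True
    then have "(\<lambda>q. X q h) \<in> smooth_funs A" by (rule vector_fieldsD(2)[OF X])
    then show ?thesis
      using f g by (simp add: vf_bracket_def vf_mult_def tangentD(4)[OF D] algebra_simps)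
  next
    case False
    then show ?thesis
      by (simp add: vf_bracket_def vf_mult_def tangentD(1)[OF D] tangent_const[OF D])
  qed
qed

lemma function_derivation_vf:
  assumes "X \<in> vector_fields A"
  shows "function_derivation (smooth_funs A) (\<lambda>f q. X q f)"
proof -
  note D = vector_fieldsD(1)[OF assms]
  show ?thesis
    by unfold_locales (auto intro: smooth_funs_add smooth_funs_mult vector_fieldsD(2)[OF assms]
        simp: tangentD(2)[OF D] tangentD(4)[OF D] tangent_const[OF D])
qed

text \<open>
  A coordinate field of a chart, multiplied by a cut-off \<open>\<rho>\<close> so that it extends by zero. Like every tangent vector
  it has to vanish on functions that are not smooth.
\<close>

definition coord_vf :: "('m \<Rightarrow> real) \<Rightarrow> 'm set \<Rightarrow> ('m \<Rightarrow> 'a) \<Rightarrow> 'a \<Rightarrow> 'm vfield" where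
  "coord_vf \<rho> U \<phi> b = (\<lambda>q f. if f \<in> smooth_funs A
     then \<rho> q * frechet_derivative (f \<circ> inv_into U \<phi>) (at (\<phi> q)) b else 0)"

lemma coord_vf:
  assumes U: "(U, \<phi>) \<in> A" and \<rho>: "\<rho> \<in> smooth_funs A"
    and C: "compact C" "C \<subseteq> U" "\<And>y. y \<notin> C \<Longrightarrow> \<rho> y = 0"
  shows "coord_vf \<rho> U \<phi> b \<in> vector_fields A" "vf_supp (coord_vf \<rho> U \<phi> b) \<subseteq> C"
proof -
  note cU = charts[OF U]
  note ch = is_chartD[OF cU]
  let ?X = "coord_vf \<rho> U \<phi> b"
  let ?d = "\<lambda>f q. frechet_derivative (f \<circ> inv_into U \<phi>) (at (\<phi> q))"
  have d: "((f \<circ> inv_into U \<phi>) has_derivative ?d f q) (at (\<phi> q))"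
    if "f \<in> smooth_funs A" "q \<in> U" for f q
    using smooth_on_has_derivative[OF smooth_funsD[OF that(1) U]] that(2) by blast
  have "?X q \<in> tangent_space A q" for q
  proof (cases "q \<in> U")
    case False
    then have "\<rho> q = 0" using C by blast
    then show ?thesis by (auto simp: coord_vf_def tangent_space_def)
  next
    case q: True
    have add: "?d (\<lambda>x. f x + g x) q = (\<lambda>v. ?d f q v + ?d g q v)"
      if "f \<in> smooth_funs A" "g \<in> smooth_funs A" for f g
      using has_derivative_add[OF d[OF that(1) q] d[OF that(2) q]]
      by (intro frechet_derivative_at[symmetric]) (simp add: o_def)
    have scale: "?d (\<lambda>x. c * f x) q = (\<lambda>v. c * ?d f q v)" if "f \<in> smooth_funs A" for c f
      using has_derivative_mult_right[OF d[OF that q], of c]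
      by (intro frechet_derivative_at[symmetric]) (simp add: o_def)
    have mult: "?d (\<lambda>x. f x * g x) q = (\<lambda>v. f q * ?d g q v + ?d f q v * g q)"
      if "f \<in> smooth_funs A" "g \<in> smooth_funs A" for f g
      using has_derivative_mult[OF d[OF that(1) q] d[OF that(2) q]]
      by (intro frechet_derivative_at[symmetric]) (simp add: o_def ch(5)[OF q])
    show ?thesis
      unfolding tangent_space_def coord_vf_def
      by (auto simp: add scale mult smooth_funs_add smooth_funs_mult algebra_simps)
  qed
  moreover have "(\<lambda>q. ?X q f) \<in> smooth_funs A" if f: "f \<in> smooth_funs A" for f
    using smooth_fun_cutoff[OF U ch(1) subset_refl compact_imp_closed[OF C(1)] C(2) \<rho> C(3)
        smooth_on_derivative[OF smooth_funsD[OF f U], of b]] f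
    by (simp add: coord_vf_def)
  ultimately show "?X \<in> vector_fields A" by (simp add: vector_fields_def)
  show "vf_supp ?X \<subseteq> C"
    unfolding vf_supp_def
  proof (rule closure_minimal[OF _ compact_imp_closed[OF C(1)]], rule subsetI, rule ccontr)
    fix q assume "q \<in> {q. ?X q \<noteq> (\<lambda>f. 0)}" "q \<notin> C"
    then show False by (auto simp: coord_vf_def C(3) fun_eq_iff split: if_splits)
  qed
qed

text \<open>
  The fields \<open>X b\<close> are cut-off coordinate fields and \<open>y b\<close> the matching coordinates. The two nested bump functions
  provide room: \<open>\<psi>\<close> is supported in the closed set \<open>C\<close> inside the region \<open>B\<close> where the frame is a genuine
  coordinate frame, so functions supported in \<open>C\<close> form an ideal that every field preserves.
\<close>

lemma local_frame:
  assumes W: "open W" "q0 \<in> W"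
  obtains \<psi> N B C X y where
    "\<psi> \<in> smooth_funs A" "open N" "q0 \<in> N" "\<And>q. q \<in> N \<Longrightarrow> \<psi> q = 1"
    "closed C" "C \<subseteq> B" "\<And>q. q \<notin> C \<Longrightarrow> \<psi> q = 0"
    "\<And>b :: 'a. X b \<in> compact_vector_fields A" "\<And>b. vf_supp (X b) \<subseteq> W"
    "\<And>b. y b \<in> smooth_funs A" "\<And>b q. b \<in> onb \<Longrightarrow> q \<in> B \<Longrightarrow> X b q (y b) = 1"
    "\<And>w q f. w \<in> vector_fields A \<Longrightarrow>
       \<psi> q * w q f = (\<Sum>b\<in>onb. \<psi> q * w q (y b) * X b q f)"
proof -
  obtain U \<phi> where U: "(U, \<phi>) \<in> A" "q0 \<in> U" by (rule chart_at)
  note cU = charts[OF U(1)]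
  note ch = is_chartD[OF cU]
  have "open (U \<inter> W)" "q0 \<in> U \<inter> W" using ch(1) W U by auto
  then obtain \<rho> B K where \<rho>: "\<rho> \<in> smooth_funs A" "open B" "q0 \<in> B" "\<And>y. y \<in> B \<Longrightarrow> \<rho> y = 1"
    and K: "compact K" "K \<subseteq> U \<inter> W" "\<And>y. y \<notin> K \<Longrightarrow> \<rho> y = 0"
    by (rule bump) blast
  obtain \<psi> N C where \<psi>: "\<psi> \<in> smooth_funs A" "open N" "q0 \<in> N" "\<And>y. y \<in> N \<Longrightarrow> \<psi> y = 1"
    and C: "compact C" "C \<subseteq> B" "\<And>y. y \<notin> C \<Longrightarrow> \<psi> y = 0"
    by (rule bump[OF \<rho>(2,3)]) blast
  have KU: "K \<subseteq> U" and KW: "K \<subseteq> W" using K(2) by auto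
  have BU: "B \<subseteq> U" using \<rho>(4) K(3) KU by (metis subset_iff zero_neq_one)
  define X where "X = coord_vf \<rho> U \<phi>"
  define y where "y b q = \<rho> q * (\<phi> q \<bullet> b)" for b q
  note cX = coord_vf[OF U(1) \<rho>(1) K(1) KU K(3), folded X_def]
  have y: "y b \<in> smooth_funs A" for b
    unfolding y_def
    by (intro smooth_fun_cutoff[OF U(1) ch(1) subset_refl compact_imp_closed[OF K(1)] KU \<rho>(1) K(3)]
        smooth_on_linear bounded_linear_inner_left ch(2))
  show thesis
  proof (rule that[of \<psi> N C B X y])
    show "X b \<in> compact_vector_fields A" for b
      using cX[of b] compact_vf_supp_subset[OF K(1)] by (auto simp: compact_vector_fields_def)
    show "vf_supp (X b) \<subseteq> W" for b using cX[of b] KW by blast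
    show "X b q (y b) = 1" if "b \<in> onb" "q \<in> B" for b q
    proof -
      have "((\<lambda>z. z \<bullet> b) has_derivative (\<lambda>v. v \<bullet> b)) (at (\<phi> q))"
        by (intro derivative_intros)
      then have "((y b \<circ> inv_into U \<phi>) has_derivative (\<lambda>v. v \<bullet> b)) (at (\<phi> q))"
        by (rule has_derivative_transform_within_open[OF _ chart_open_image[OF cU \<rho>(2) BU]])
           (use that(2) BU in \<open>auto simp: y_def ch(5) \<rho>(4) subset_iff\<close>)
      then have "frechet_derivative (y b \<circ> inv_into U \<phi>) (at (\<phi> q)) = (\<lambda>v. v \<bullet> b)"
        by (rule frechet_derivative_at[symmetric])
      then show ?thesis using that y by (simp add: X_def coord_vf_def \<rho>(4) onb_inner)
    qed
    show "\<psi> q * w q f = (\<Sum>b\<in>onb. \<psi> q * w q (y b) * X b q f)" if w: "w \<in> vector_fields A" for w q f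
    proof (cases "q \<in> B \<and> f \<in> smooth_funs A")
      case True
      then have "w q f = (\<Sum>b\<in>onb. w q (y b) * X b q f)"
        using tangent_expand[OF vector_fieldsD(1)[OF w] U(1) _ \<rho>(1,2) _ \<rho>(4) K(1) KU K(3), where q=q and f=f]
        by (simp add: X_def coord_vf_def \<rho>(4) y_def[abs_def])
      then show ?thesis by (simp add: sum_distrib_left mult.assoc)
    next
      case False
      show ?thesis
      proof (cases "q \<in> B")
        case True
        with False have "f \<notin> smooth_funs A" by blast
        then show ?thesis by (simp add: X_def coord_vf_def tangentD(1)[OF vector_fieldsD(1)[OF w]])
      next
        case False
        then have "\<psi> q = 0" using C by blast
        then show ?thesis by simp
      qed
    qed
  qed (use \<psi> C y in \<open>auto simp: compact_imp_closed\<close>)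
qed

section \<open>Ideals of finite codimension\<close>

text \<open>
  The functionals \<open>T _ i\<close> present an ideal \<open>J\<close> of finite codimension as their common kernel. By
  \<open>derivative_ideal_subset\<close>, \<open>J\<close> contains all multiples of a coordinate field with suitably small support, hence
  \<open>\<psi> w\<close> for all \<open>w \<in> L\<close> and a bump function \<open>\<psi>\<close> around any given point of \<open>W\<close>. Finitely many of these \<open>\<psi>\<close> suffice
  for the support of \<open>v\<close>. Instead of normalising them to a partition of unity, write \<open>v = \<psi> v + (1 - \<psi>) v\<close> and
  iterate on the second
  summand: in the end it carries the product of all \<open>1 - \<psi>\<close>, which vanishes on the support.
\<close>

lemma no_finite_codim_ideal:
  fixes W :: "'m set" and T :: "'m vfield \<Rightarrow> 'i \<Rightarrow> real"
  assumes W: "open W" and L_def: "L = {v \<in> compact_vector_fields A. vf_supp v \<subseteq> W}"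
    and I: "finite I"
    and T_add: "\<And>v w i. v \<in> L \<Longrightarrow> w \<in> L \<Longrightarrow> i \<in> I \<Longrightarrow> T (vf_add v w) i = T v i + T w i"
    and T_scale: "\<And>c v i. v \<in> L \<Longrightarrow> i \<in> I \<Longrightarrow> T (vf_scale c v) i = c * T v i"
    and ideal: "\<And>v w i. v \<in> L \<Longrightarrow> w \<in> L \<Longrightarrow> \<forall>i\<in>I. T v i = 0 \<Longrightarrow> i \<in> I \<Longrightarrow> T (vf_bracket v w) i = 0"
    and v: "v \<in> L" and i: "i \<in> I"
  shows "T v i = 0"
proof -
  define J where "J = {v \<in> L. \<forall>i\<in>I. T v i = 0}"
  have LD: "w \<in> vector_fields A" "compact (vf_supp w)" if "w \<in> L" for w
    using that by (auto simp: L_def compact_vector_fields_def)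
  have L_mult: "vf_mult f w \<in> L" if "f \<in> smooth_funs A" "w \<in> L" for f w
    using vf_mult_closed[OF that(1) LD(1)[OF that(2)]] vf_supp_mult[of f w]
      compact_vf_supp_subset[OF LD(2)[OF that(2)], of "vf_mult f w"] that(2)
    by (auto simp: L_def compact_vector_fields_def)
  have scale: "vf_scale c w = vf_mult (\<lambda>q. c) w" for c w by (simp add: vf_scale_def vf_mult_def)
  have L_add: "vf_add w w' \<in> L" if "w \<in> L" "w' \<in> L" for w w'
    using vf_add_closed[OF LD(1)[OF that(1)] LD(1)[OF that(2)]] vf_supp_add[of w w']
      compact_vf_supp_subset[OF compact_Un[OF LD(2)[OF that(1)] LD(2)[OF that(2)]], of "vf_add w w'"] that
    by (auto simp: L_def compact_vector_fields_def)
  have J_add: "vf_add w w' \<in> J" if "w \<in> J" "w' \<in> J" for w w'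
    using that by (auto simp: J_def T_add L_add)
  have J_scale: "vf_scale c w \<in> J" if "w \<in> J" for c w
    using that L_mult[of "\<lambda>q. c" w] by (auto simp: J_def T_scale scale[symmetric])
  have J_zero: "(\<lambda>q f. 0) \<in> J"
  proof -
    have "T (vf_scale 0 v) i = 0" if "i \<in> I" for i using T_scale[OF v that, of 0] by simp
    then show ?thesis using L_mult[of "\<lambda>q. 0" v] v by (auto simp: J_def vf_scale_def vf_mult_def)
  qed

  have one_direction: "vf_mult h X \<in> J"
    if X: "X \<in> L" and y: "y \<in> smooth_funs A" "\<And>q. q \<in> B \<Longrightarrow> X q y = 1"
      and C: "closed C" "C \<subseteq> B" and h: "h \<in> smooth_funs A" "\<And>q. q \<notin> C \<Longrightarrow> h q = 0"
    for h X y B C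
  proof -
    note XV = LD(1)[OF X]
    interpret X: function_derivation "smooth_funs A" "\<lambda>f q. X q f" by (rule function_derivation_vf[OF XV])
    define F where "F = {f \<in> smooth_funs A. vf_mult f X \<in> J}"
    define H where "H = {h \<in> smooth_funs A. \<forall>q. q \<notin> C \<longrightarrow> h q = 0}"
    define l where "l i p = T (vf_mult (\<lambda>q. poly p (y q)) X) i" for i p
    \<comment> \<open>The polynomials in \<open>y\<close> form a space of infinite dimension, so one of them lands in \<open>F\<close>.\<close>
    have "\<exists>p. p \<noteq> 0 \<and> monom 1 1 dvd p \<and> (\<forall>i\<in>I. l i p = 0)"
    proof (rule poly_annihilator[OF I])
      show "l i (p + r) = l i p + l i r" if "i \<in> I" for i p r
        using T_add[OF L_mult[OF X.A_poly[OF y(1)] X] L_mult[OF X.A_poly[OF y(1)] X] that]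
        by (simp add: l_def vf_add_def vf_mult_def algebra_simps)
      show "l i (smult c p) = c * l i p" if "i \<in> I" for i c p
        using T_scale[OF L_mult[OF X.A_poly[OF y(1)] X] that]
        by (simp add: l_def vf_scale_def vf_mult_def algebra_simps)
    qed
    then obtain p where p: "p \<noteq> 0" "monom 1 1 dvd p" "\<forall>i\<in>I. l i p = 0" by blast
    have "H \<subseteq> F"
    proof (rule X.derivative_ideal_subset[of F y p H])
      show "F \<subseteq> smooth_funs A" "H \<subseteq> smooth_funs A" by (auto simp: F_def H_def)
      show "(\<lambda>q. f q + g q) \<in> F" if "f \<in> F" "g \<in> F" for f g
        using that J_add[of "vf_mult f X" "vf_mult g X"]
        by (auto simp: F_def smooth_funs_add vf_add_def vf_mult_def algebra_simps)
      show "(\<lambda>q. c * f q) \<in> F" if "f \<in> F" for c f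
        using that J_scale[of "vf_mult f X" c]
        by (auto simp: F_def smooth_funs_mult vf_scale_def vf_mult_def algebra_simps)
      show "(\<lambda>q. f q * X q g - g q * X q f) \<in> F" if "f \<in> F" "g \<in> smooth_funs A" for f g
      proof -
        have f: "f \<in> smooth_funs A" "vf_mult f X \<in> L" "\<forall>i\<in>I. T (vf_mult f X) i = 0"
          using that(1) by (auto simp: F_def J_def)
        let ?k = "\<lambda>q. f q * X q g - g q * X q f"
        have k: "?k \<in> smooth_funs A"
          by (intro smooth_funs_diff smooth_funs_mult f that X.X_closed)
        have "T (vf_mult ?k X) i = 0" if i: "i \<in> I" for i
          using ideal[OF f(2) L_mult[OF \<open>g \<in> _\<close> X] f(3) i] vf_bracket_mult[OF XV f(1) \<open>g \<in> _\<close>]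
          by simp
        then show ?thesis using k L_mult[OF k X] by (simp add: F_def J_def)
      qed
      show "y \<in> smooth_funs A" "p \<noteq> 0" by fact+
      show "poly p 0 = 0" using p(2) by (auto simp: dvd_def poly_monom)
      show "(\<lambda>q. poly p (y q)) \<in> F"
        using p(3) X.A_poly[OF y(1)] L_mult[OF X.A_poly[OF y(1)] X] by (simp add: F_def J_def l_def)
      show "(\<lambda>q. h q * f q) \<in> H" if "h \<in> H" "f \<in> smooth_funs A" for h f
        using that by (auto simp: H_def smooth_funs_mult)
      show "(\<lambda>q. X q h) \<in> H" if h: "h \<in> H" for h
      proof -
        have "X q h = 0" if "q \<notin> C" for q
          using tangent_local[OF vector_fieldsD(1)[OF XV], of h "\<lambda>q. 0" "- C" q]
            tangent_const[OF vector_fieldsD(1)[OF XV], of q 0] h that C(1)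
          by (auto simp: H_def open_Compl)
        then show ?thesis using h X.X_closed by (simp add: H_def)
      qed
      show "h q * X q y = h q" if "h \<in> H" for h q
        using that y(2)[of q] C(2) by (cases "q \<in> C") (auto simp: H_def)
    qed
    moreover have "h \<in> H" using h by (simp add: H_def)
    ultimately show ?thesis by (auto simp: F_def)
  qed

  have local: "\<exists>\<psi> N. \<psi> \<in> smooth_funs A \<and> open N \<and> q \<in> N \<and> (\<forall>q\<in>N. \<psi> q = 1) \<and>
      (\<forall>w\<in>L. vf_mult \<psi> w \<in> J)" if q: "q \<in> W" for q
  proof -
    obtain \<psi> N B C X y where \<psi>: "\<psi> \<in> smooth_funs A" "open N" "q \<in> N" "\<And>q. q \<in> N \<Longrightarrow> \<psi> q = 1"
      and C: "closed C" "C \<subseteq> B" "\<And>q. q \<notin> C \<Longrightarrow> \<psi> q = 0"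
      and X: "\<And>b :: 'a. X b \<in> compact_vector_fields A" "\<And>b. vf_supp (X b) \<subseteq> W"
      and y: "\<And>b. y b \<in> smooth_funs A" "\<And>b q. b \<in> onb \<Longrightarrow> q \<in> B \<Longrightarrow> X b q (y b) = 1"
      and span: "\<And>w q f. w \<in> vector_fields A \<Longrightarrow>
         \<psi> q * w q f = (\<Sum>b\<in>onb. \<psi> q * w q (y b) * X b q f)"
      by (rule local_frame[OF W q]) blast
    have "vf_mult \<psi> w \<in> J" if w: "w \<in> L" for w
    proof -
      have term_in: "vf_mult (\<lambda>q. \<psi> q * w q (y b)) (X b) \<in> J" if "b \<in> onb" for b
        by (rule one_direction[of "X b" "y b" B C])
          (use X y that C \<psi>(1) in \<open>auto simp: L_def intro!: smooth_funs_mult vector_fieldsD(2)[OF LD(1)[OF w]]\<close>)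
      have "(\<lambda>q f. \<Sum>b\<in>S. vf_mult (\<lambda>q. \<psi> q * w q (y b)) (X b) q f) \<in> J"
        if "finite S" "S \<subseteq> onb" for S
        using that
      proof (induction S)
        case (insert b S)
        then show ?case
          using J_add[OF term_in, of b "\<lambda>q f. \<Sum>b\<in>S. vf_mult (\<lambda>q. \<psi> q * w q (y b)) (X b) q f"]
          by (simp add: vf_add_def)
      qed (simp add: J_zero)
      from this[of onb] have "(\<lambda>q f. \<Sum>b\<in>onb. \<psi> q * w q (y b) * X b q f) \<in> J"
        by (simp add: vf_mult_def)
      moreover have "vf_mult \<psi> w = (\<lambda>q f. \<Sum>b\<in>onb. \<psi> q * w q (y b) * X b q f)"
        unfolding vf_mult_def by (intro ext span LD(1)[OF w])
      ultimately show ?thesis by simp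
    qed
    with \<psi> show ?thesis by blast
  qed

  have telescope: "w \<in> J"
    if "finite \<Psi>" "\<Psi> \<subseteq> {\<psi> \<in> smooth_funs A. \<forall>w\<in>L. vf_mult \<psi> w \<in> J}" "w \<in> L"
      "\<And>q f. (\<Prod>\<psi>\<in>\<Psi>. 1 - \<psi> q) * w q f = 0" for \<Psi> w
    using that
  proof (induction \<Psi> arbitrary: w)
    case empty
    then have "w = (\<lambda>q f. 0)" by (simp add: fun_eq_iff)
    then show ?case using J_zero by simp
  next
    case (insert \<psi> \<Psi>)
    have \<psi>: "\<psi> \<in> smooth_funs A" "vf_mult \<psi> w \<in> J" using insert.prems by auto
    let ?w = "vf_mult (\<lambda>q. 1 - \<psi> q) w"
    have "?w \<in> J"
    proof (rule insert.IH)
      show "?w \<in> L" by (intro L_mult smooth_funs_diff smooth_funs_const \<psi> insert.prems)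
      show "(\<Prod>\<psi>\<in>\<Psi>. 1 - \<psi> q) * ?w q f = 0" for q f
        using insert.prems(3)[of q f] insert.hyps by (auto simp: vf_mult_def)
    qed (use insert.prems in auto)
    from J_add[OF \<psi>(2) this] show ?case by (simp add: vf_add_def vf_mult_def algebra_simps)
  qed

  obtain \<psi> N where *: "\<And>q. q \<in> W \<Longrightarrow> \<psi> q \<in> smooth_funs A \<and> open (N q) \<and> q \<in> N q \<and>
      (\<forall>q'\<in>N q. \<psi> q q' = 1) \<and> (\<forall>w\<in>L. vf_mult (\<psi> q) w \<in> J)"
    using local by metis
  have sv: "vf_supp v \<subseteq> W" using v by (simp add: L_def)
  obtain Q where Q: "Q \<subseteq> vf_supp v" "finite Q" "vf_supp v \<subseteq> (\<Union>q\<in>Q. N q)"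
    by (rule compactE_image[OF LD(2)[OF v], of "vf_supp v" N]) (use * sv in blast)+
  have "v \<in> J"
  proof (rule telescope[of "\<psi> ` Q"])
    show "\<psi> ` Q \<subseteq> {\<psi> \<in> smooth_funs A. \<forall>w\<in>L. vf_mult \<psi> w \<in> J}" using * Q(1) sv by blast
    show "(\<Prod>\<psi>\<in>\<psi> ` Q. 1 - \<psi> q) * v q f = 0" for q f
    proof (cases "q \<in> vf_supp v")
      case True
      then obtain s where "s \<in> Q" "q \<in> N s" using Q(3) by blast
      then have "\<psi> s q = 1" using * Q(1) sv by blast
      then have "(\<Prod>\<psi>\<in>\<psi> ` Q. 1 - \<psi> q) = 0" using Q(2) \<open>s \<in> Q\<close> by (auto simp: prod_zero_iff)
      then show ?thesis by simp
    qed (simp add: vf_zero_off_supp)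
  qed (use Q v in auto)
  then show ?thesis using i by (simp add: J_def)
qed

end

section \<open>Smooth maps\<close>

lemma smooth_funs_compose:
  assumes "smooth_manifold A" "smooth_manifold B"
    and F: "smooth_map A UNIV B F" and f: "f \<in> smooth_funs B"
  shows "f \<circ> F \<in> smooth_funs A"
proof -
  interpret A: smooth_manifold A by fact
  interpret B: smooth_manifold B by fact
  show ?thesis
    unfolding A.smooth_funs_iff
  proof (safe, rule smooth_on_local)
    fix U \<phi> y assume U: "(U, \<phi>) \<in> A" and "y \<in> \<phi> ` U"
    then obtain q where q: "q \<in> U" "y = \<phi> q" by blast
    obtain V \<psi> where V: "(V, \<psi>) \<in> B" "F q \<in> V" by (rule B.chart_at)
    note cU = A.charts[OF U] and cV = B.charts[OF V(1)]
    let ?T = "\<phi> ` (U \<inter> F -` V)"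
    have "open (F -` V)"
      using F is_chartD(1)[OF cV] by (auto simp: smooth_map_def intro: open_vimage)
    then have oT: "open ?T" using is_chartD(1)[OF cU] by (intro chart_open_image[OF cU]) auto
    have "smooth_on (\<psi> \<circ> F \<circ> inv_into U \<phi>) ?T"
      using F U V(1) by (auto simp: smooth_map_def dest!: bspec)
    then have "smooth_on (\<lambda>x. (f \<circ> inv_into V \<psi>) ((\<psi> \<circ> F \<circ> inv_into U \<phi>) x)) ?T"
      by (rule smooth_on_compose[OF _ B.smooth_funsD[OF f V(1)] oT is_chartD(2)[OF cV]])
        (auto simp: is_chartD(5)[OF cU])
    then have "smooth_on (f \<circ> F \<circ> inv_into U \<phi>) ?T"
      by (rule smooth_on_cong[OF _ oT]) (auto simp: is_chartD(5)[OF cU] is_chartD(5)[OF cV])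
    with oT q V(2) show "\<exists>T. open T \<and> y \<in> T \<and> smooth_on (f \<circ> F \<circ> inv_into U \<phi>) T"
      by blast
  qed
qed

lemma inv_into_map_prod:
  assumes "inj_on f A" "inj_on g B" "a \<in> A" "b \<in> B"
  shows "inv_into (A \<times> B) (map_prod f g) (f a, g b) = (a, b)"
proof -
  have "inj_on (map_prod f g) (A \<times> B)" using assms(1,2) by (rule map_prod_inj_on)
  then show ?thesis using inv_into_f_f[of "map_prod f g" "A \<times> B" "(a, b)"] assms by simp
qed

lemma is_chart_map_prod:
  assumes U: "is_chart U \<phi>" and V: "is_chart V \<psi>"
  shows "is_chart (U \<times> V) (map_prod \<phi> \<psi>)"
proof -
  note u = is_chartD[OF U] and v = is_chartD[OF V]
  note inv = inv_into_map_prod[OF chart_inj_on[OF U] chart_inj_on[OF V]]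
  have im: "map_prod \<phi> \<psi> ` (U \<times> V) = \<phi> ` U \<times> \<psi> ` V" by force
  have "continuous_on (U \<times> V) (map_prod \<phi> \<psi>)"
    unfolding map_prod_def split_beta
    by (intro continuous_intros continuous_on_compose2[OF u(3)] continuous_on_compose2[OF v(3)]) auto
  moreover have "continuous_on (\<phi> ` U \<times> \<psi> ` V) (inv_into (U \<times> V) (map_prod \<phi> \<psi>))"
  proof (rule continuous_on_eq)
    show "continuous_on (\<phi> ` U \<times> \<psi> ` V) (\<lambda>z. (inv_into U \<phi> (fst z), inv_into V \<psi> (snd z)))"
      by (intro continuous_intros continuous_on_compose2[OF u(4)] continuous_on_compose2[OF v(4)]) auto
  qed (auto simp: u(5) v(5) inv)
  ultimately show ?thesis
    unfolding is_chart_def im homeomorphism_def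
    using u(1,2) v(1,2) by (auto simp: inv open_Times image_iff)
qed

section \<open>Principal bundles\<close>

context principal_bundle
begin

lemma proj_pullback: "f \<in> smooth_funs AM \<Longrightarrow> f \<circ> \<pi> \<in> smooth_funs AP"
  using smooth_funs_compose[OF P.smooth_manifold_axioms M.smooth_manifold_axioms smooth_proj] .

lemma trivialization:
  obtains U \<Phi> where "x \<in> U" "open U" "bij_betw \<Phi> (\<pi> -` U) (U \<times> UNIV)"
    "smooth_map AP (\<pi> -` U) (prod_atlas AM AG) \<Phi>"
    "smooth_map (prod_atlas AM AG) (U \<times> UNIV) AP (inv_into (\<pi> -` U) \<Phi>)"
    "\<And>p. p \<in> \<pi> -` U \<Longrightarrow> fst (\<Phi> p) = \<pi> p"
    "\<And>p g. p \<in> \<pi> -` U \<Longrightarrow> \<Phi> (act p g) = (\<pi> p, mult (snd (\<Phi> p)) g)"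
proof -
  from locally_trivial[of x] show thesis
  proof (elim exE conjE)
    fix U \<Phi>
    assume *: "x \<in> U" "open U" "bij_betw \<Phi> (\<pi> -` U) (U \<times> UNIV)"
      "smooth_map AP (\<pi> -` U) (prod_atlas AM AG) \<Phi>"
      "smooth_map (prod_atlas AM AG) (U \<times> UNIV) AP (inv_into (\<pi> -` U) \<Phi>)"
      and **: "\<forall>p\<in>\<pi> -` U. fst (\<Phi> p) = \<pi> p \<and> (\<forall>g. \<Phi> (act p g) = (\<pi> p, mult (snd (\<Phi> p)) g))"
    show thesis by (rule that[of U \<Phi>]) (use * bspec[OF **] in simp_all)
  qed
qed

lemma proj_surj: obtains p where "\<pi> p = x"
proof (rule trivialization[of x])
  fix U and \<Phi> :: "'p \<Rightarrow> 'm \<times> 'g"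
  assume U: "x \<in> U" "bij_betw \<Phi> (\<pi> -` U) (U \<times> UNIV)"
    and fst: "\<And>p. p \<in> \<pi> -` U \<Longrightarrow> fst (\<Phi> p) = \<pi> p"
  have "(x, e) \<in> \<Phi> ` (\<pi> -` U)" using U by (simp add: bij_betw_def)
  then obtain p where "p \<in> \<pi> -` U" "\<Phi> p = (x, e)" by (metis imageE)
  with fst have "\<pi> p = x" by (metis fst_conv)
  then show thesis by (rule that)
qed

lemma fibre_transitive:
  assumes "\<pi> p = \<pi> q"
  obtains g where "q = act p g"
proof -
  obtain U \<Phi> where U: "\<pi> p \<in> U" "bij_betw \<Phi> (\<pi> -` U) (U \<times> UNIV)"
    and fst: "\<And>p. p \<in> \<pi> -` U \<Longrightarrow> fst (\<Phi> p) = \<pi> p"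
    and \<Phi>: "\<And>p g. p \<in> \<pi> -` U \<Longrightarrow> \<Phi> (act p g) = (\<pi> p, mult (snd (\<Phi> p)) g)"
    by (rule trivialization[of "\<pi> p"], rule that)
  define g where "g = mult (ginv (snd (\<Phi> p))) (snd (\<Phi> q))"
  have p: "p \<in> \<pi> -` U" and q: "q \<in> \<pi> -` U" using U assms by auto
  have "mult (snd (\<Phi> p)) g = snd (\<Phi> q)"
    unfolding g_def by (metis G.assoc G.left_inverse G.right_inverse G.left_neutral)
  then have "\<Phi> (act p g) = \<Phi> q" using \<Phi>[OF p, of g] fst[OF q] assms by (simp add: prod_eq_iff)
  moreover have "act p g \<in> \<pi> -` U" using p by (simp add: proj_act)
  ultimately have "q = act p g" using U(2) q by (metis bij_betw_def inj_on_def)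
  then show thesis by (rule that)
qed

text \<open>
  \<open>pushforward\<close> is a definite description, so its meaning rests on unique existence: the images of \<open>w\<close> along a fibre
  agree because \<open>w\<close> is invariant and the group acts transitively on fibres, and uniqueness holds as \<open>\<pi>\<close> is surjective.
\<close>

lemma pushforward_invariant:
  assumes w: "w \<in> invariant_vector_fields AP \<pi> act"
  shows "differential AM \<pi> (w p) = pushforward AM \<pi> w (\<pi> p)"
proof -
  let ?d = "\<lambda>p. differential AM \<pi> (w p)"
  have inv: "differential AP (\<lambda>q. act q g) (w p) = w (act p g)" for p g
    using w by (simp add: invariant_vector_fields_def)
  have "?d (act p g) = ?d p" for p g
  proof
    fix f
    show "?d (act p g) f = ?d p f"
      using proj_pullback[of f]
      by (simp add: inv[symmetric] differential_def o_def proj_act)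
  qed
  then have const: "?d p = ?d q" if "\<pi> p = \<pi> q" for p q
    using fibre_transitive[OF that] by metis
  have "\<exists>!v. \<forall>p. ?d p = v (\<pi> p)"
  proof (rule ex1I)
    show "\<forall>p. ?d p = ?d (SOME q. \<pi> q = \<pi> p)"
    proof
      fix p
      have "\<pi> (SOME q. \<pi> q = \<pi> p) = \<pi> p" by (rule someI[of _ p]) simp
      then show "?d p = ?d (SOME q. \<pi> q = \<pi> p)" by (intro const) simp
    qed
  next
    fix v assume v: "\<forall>p. ?d p = v (\<pi> p)"
    show "v = (\<lambda>x. ?d (SOME q. \<pi> q = x))"
    proof
      fix x
      obtain p where "\<pi> p = x" by (rule proj_surj)
      then have "\<pi> (SOME q. \<pi> q = x) = x" by (rule someI)
      then show "v x = ?d (SOME q. \<pi> q = x)" using v by metis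
    qed
  qed
  then have "\<forall>p. ?d p = pushforward AM \<pi> w (\<pi> p)"
    unfolding pushforward_def by (rule theI')
  then show ?thesis by (rule spec)
qed

text \<open>
  In a local trivialization with \<open>p\<close> at \<open>(x, g\<^sub>0)\<close>, compare \<open>h\<close> with the pullback \<open>\<mu> \<circ> \<pi>\<close> of its restriction
  \<open>\<mu>(a) = h(a, g\<^sub>0)\<close> to a horizontal slice; \<open>D\<close> kills the pullback. The difference \<open>k(a, g) = h(a, g) - h(a, g\<^sub>0)\<close>
  vanishes on the slice, and on the fibre since \<open>h\<close> does, so all its partial derivatives at \<open>p\<close> are zero and \<open>D k = 0\<close>
  by \<open>tangent_critical\<close>. Trivializations are not charts of the atlas, so the derivative of \<open>k\<close> is computed in product
  charts and carried over by the chain rule.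
\<close>

lemma vertical_tangent_to_fibre:
  assumes D: "D \<in> tangent_space AP p"
    and vert: "\<And>f. f \<in> smooth_funs AM \<Longrightarrow> D (f \<circ> \<pi>) = 0"
    and h: "h \<in> smooth_funs AP" and fibre: "\<And>q. \<pi> q = \<pi> p \<Longrightarrow> h q = 0"
  shows "D h = 0"
proof -
  obtain U \<Phi> where U: "\<pi> p \<in> U" "open U" "bij_betw \<Phi> (\<pi> -` U) (U \<times> UNIV)"
    and sm: "smooth_map AP (\<pi> -` U) (prod_atlas AM AG) \<Phi>"
    and smJ: "smooth_map (prod_atlas AM AG) (U \<times> UNIV) AP (inv_into (\<pi> -` U) \<Phi>)"
    and fst: "\<And>p. p \<in> \<pi> -` U \<Longrightarrow> fst (\<Phi> p) = \<pi> p"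
    by (rule trivialization[of "\<pi> p"], rule that)
  define J where "J = inv_into (\<pi> -` U) \<Phi>"
  have J\<Phi>: "J (\<Phi> q) = q" if "q \<in> \<pi> -` U" for q
    unfolding J_def by (rule bij_betw_inv_into_left[OF U(3) that])
  have \<pi>J: "\<pi> (J (a, g)) = a" if "a \<in> U" for a g
  proof -
    have ag: "(a, g) \<in> U \<times> UNIV" using that by simp
    have "J (a, g) \<in> \<pi> -` U" unfolding J_def using ag U(3) by (metis bij_betw_def inv_into_into)
    moreover have "\<Phi> (J (a, g)) = (a, g)" unfolding J_def by (rule bij_betw_inv_into_right[OF U(3) ag])
    ultimately show ?thesis using fst by fastforce
  qed
  define x g0 where "x = \<pi> p" and "g0 = snd (\<Phi> p)"
  have p: "p \<in> \<pi> -` U" "\<Phi> p = (x, g0)" "x \<in> U" "J (x, g0) = p"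
  proof -
    show "p \<in> \<pi> -` U" "x \<in> U" using U(1) by (simp_all add: x_def)
    then show "\<Phi> p = (x, g0)" using fst by (simp add: x_def g0_def prod_eq_iff)
    then show "J (x, g0) = p" using J\<Phi>[of p] U(1) by simp
  qed
  obtain V \<psi> where V: "(V, \<psi>) \<in> AM" "x \<in> V" by (rule M.chart_at)
  obtain V' \<psi>' where V': "(V', \<psi>') \<in> AG" "g0 \<in> V'" by (rule G.chart_at)
  obtain UP \<phi> where UP: "(UP, \<phi>) \<in> AP" "p \<in> UP" by (rule P.chart_at)
  note cV = M.charts[OF V(1)] and cV' = G.charts[OF V'(1)] and cP = P.charts[OF UP(1)]
  note cVV = is_chart_map_prod[OF cV cV']
  let ?\<chi> = "map_prod \<psi> \<psi>'" and ?i = "inv_into (V \<times> V') (map_prod \<psi> \<psi>')"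
  have VV: "(V \<times> V', ?\<chi>) \<in> prod_atlas AM AG" using V V' by (auto simp: prod_atlas_def)
  note inv = inv_into_map_prod[OF chart_inj_on[OF cV] chart_inj_on[OF cV']]
  \<comment> \<open>the part of the product chart where \<open>h\<close>, read through the trivialization, is seen to be smooth\<close>
  define \<Omega>0 where "\<Omega>0 = V \<times> V' \<inter> U \<times> UNIV \<inter> J -` UP"
  define \<Omega> where "\<Omega> = ?\<chi> ` \<Omega>0"
  have o\<Omega>0: "open \<Omega>0"
  proof -
    have "continuous_on (U \<times> UNIV) J" using smJ by (simp add: smooth_map_def J_def)
    then have "open (J -` UP \<inter> U \<times> UNIV)"
      using continuous_on_open_vimage[of "U \<times> UNIV" J] U(2) is_chartD(1)[OF cP]
      by (simp add: open_Times)
    then have "open ((V \<times> V') \<inter> (J -` UP \<inter> U \<times> UNIV))"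
      using is_chartD(1)[OF cVV] by (rule open_Int[rotated])
    then show ?thesis by (simp add: \<Omega>0_def Int_ac)
  qed
  have \<Omega>0V: "\<Omega>0 \<subseteq> V \<times> V'" by (auto simp: \<Omega>0_def)
  have o\<Omega>: "open \<Omega>" unfolding \<Omega>_def by (rule chart_open_image[OF cVV o\<Omega>0 \<Omega>0V])
  define hh where "hh = h \<circ> J \<circ> ?i"
  have hh: "hh (\<psi> a, \<psi>' g) = h (J (a, g))" if "a \<in> V" "g \<in> V'" for a g
    by (simp add: hh_def inv that)
  have shh: "smooth_on hh \<Omega>"
  proof -
    have "smooth_on (\<phi> \<circ> J \<circ> ?i) \<Omega>"
      using smJ VV UP(1) unfolding smooth_map_def J_def[symmetric] \<Omega>_def \<Omega>0_def by fast
    then have "smooth_on (\<lambda>z. (h \<circ> inv_into UP \<phi>) ((\<phi> \<circ> J \<circ> ?i) z)) \<Omega>"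
      by (rule smooth_on_compose[OF _ P.smooth_funsD[OF h UP(1)] o\<Omega> is_chartD(2)[OF cP]])
         (auto simp: \<Omega>_def \<Omega>0_def inv)
    then show ?thesis
      by (rule smooth_on_cong[OF _ o\<Omega>])
         (auto simp: \<Omega>_def \<Omega>0_def inv hh_def is_chartD(5)[OF cP])
  qed
  have z0: "(x, g0) \<in> \<Omega>0" using p V V' UP by (simp add: \<Omega>0_def)
  then have z0': "(\<psi> x, \<psi>' g0) \<in> \<Omega>" by (force simp: \<Omega>_def)

  define W1 where "W1 = {a. (a, g0) \<in> \<Omega>0}"
  have "W1 = (\<lambda>a. (a, g0)) -` \<Omega>0" by (auto simp: W1_def)
  then have W1: "open W1" "W1 \<subseteq> V" "x \<in> W1"
    using o\<Omega>0 z0 \<Omega>0V by (auto simp: W1_def intro!: open_vimage continuous_intros)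
  obtain \<rho> N C where \<rho>: "\<rho> \<in> smooth_funs AM" "open N" "x \<in> N" "\<And>a. a \<in> N \<Longrightarrow> \<rho> a = 1"
    and C: "compact C" "C \<subseteq> W1" "\<And>a. a \<notin> C \<Longrightarrow> \<rho> a = 0"
    by (rule M.bump[OF W1(1,3)]) blast
  have NV: "N \<subseteq> V" using \<rho>(4) C(2,3) W1(2) by (metis subset_iff zero_neq_one)
  define \<mu> where "\<mu> a = \<rho> a * h (J (a, g0))" for a
  have \<mu>: "\<mu> \<in> smooth_funs AM"
  proof (rule M.smooth_fun_extend[OF V(1) W1(1,2) compact_imp_closed[OF C(1)] C(2)])
    have oW: "open (\<psi> ` W1)" by (rule chart_open_image[OF cV W1(1,2)])
    have "bounded_linear (\<lambda>y. (y, 0 :: 'b))"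
      by (intro bounded_linear_Pair bounded_linear_ident bounded_linear_zero)
    then have "smooth_on (\<lambda>y. (y, 0) + (0, \<psi>' g0)) (\<psi> ` W1)"
      by (intro smooth_on_add smooth_on_linear smooth_on_const oW)
    then have "smooth_on (\<lambda>y. hh ((y, 0) + (0, \<psi>' g0))) (\<psi> ` W1)"
      by (rule smooth_on_compose[OF _ shh oW o\<Omega>]) (force simp: \<Omega>_def W1_def)
    moreover have "smooth_on (\<rho> \<circ> inv_into V \<psi>) (\<psi> ` W1)"
      by (rule smooth_on_subset[OF M.smooth_funsD[OF \<rho>(1) V(1)] image_mono[OF W1(2)]])
    ultimately have "smooth_on (\<lambda>y. (\<rho> \<circ> inv_into V \<psi>) y * hh ((y, 0) + (0, \<psi>' g0))) (\<psi> ` W1)"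
      by (intro smooth_on_mult oW)
    then show "smooth_on (\<mu> \<circ> inv_into V \<psi>) (\<psi> ` W1)"
      by (rule smooth_on_cong[OF _ oW])
         (use W1(2) V'(2) in \<open>auto simp: \<mu>_def is_chartD(5)[OF cV] hh subset_iff\<close>)
  qed (simp add: \<mu>_def C(3))
  define k where "k q = h q - (\<mu> \<circ> \<pi>) q" for q
  note \<mu>\<pi> = proj_pullback[OF \<mu>]
  have k: "k \<in> smooth_funs AP" unfolding k_def by (rule P.smooth_funs_diff[OF h \<mu>\<pi>])

  \<comment> \<open>\<open>K\<close> is \<open>k\<close> in the product chart\<close>
  define K where "K z = hh z - hh (fst z, \<psi>' g0)" for z
  define L where "L = frechet_derivative hh (at (\<psi> x, \<psi>' g0))"
  have L: "(hh has_derivative L) (at (\<psi> x, \<psi>' g0))"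
    unfolding L_def by (rule smooth_on_has_derivative[OF shh z0'])
  have L0: "L (0, v) = 0" for v
  proof -
    have "((\<lambda>w. (\<psi> x, w)) has_derivative (\<lambda>v. (0, v))) (at (\<psi>' g0))"
      by (intro derivative_intros)
    from has_derivative_compose[OF this L]
    have 1: "((\<lambda>w. hh (\<psi> x, w)) has_derivative (\<lambda>v. L (0, v))) (at (\<psi>' g0))" .
    have "open ((\<lambda>w. (\<psi> x, w)) -` \<Omega>)" by (intro open_vimage o\<Omega> continuous_intros)
    moreover have "hh (\<psi> x, w) = 0" if w: "w \<in> (\<lambda>w. (\<psi> x, w)) -` \<Omega>" for w
    proof -
      obtain a g where ag: "(a, g) \<in> \<Omega>0" "\<psi> x = \<psi> a" "w = \<psi>' g"
        using w by (auto simp: \<Omega>_def)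
      then have "a = x" using \<Omega>0V V(2) chart_inj_on[OF cV] by (auto simp: inj_on_def)
      with ag have "hh (\<psi> x, w) = h (J (x, g))" using \<Omega>0V by (auto intro: hh)
      also have "\<dots> = 0" by (rule fibre) (simp add: \<pi>J p(3) x_def[symmetric])
      finally show ?thesis .
    qed
    ultimately have "((\<lambda>w. hh (\<psi> x, w)) has_derivative (\<lambda>v. 0)) (at (\<psi>' g0))"
      using z0' by (intro has_derivative_transform_within_open[OF has_derivative_const[of 0]]) auto
    from has_derivative_unique[OF 1 this] show ?thesis by metis
  qed
  have dK: "(K has_derivative (\<lambda>v. 0)) (at (\<psi> x, \<psi>' g0))"
  proof -
    have "((\<lambda>z. (fst z, \<psi>' g0)) has_derivative (\<lambda>v. (fst v, 0))) (at (\<psi> x, \<psi>' g0))"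
      by (intro derivative_intros)
    from has_derivative_compose[OF this, of hh L] L
    have "((\<lambda>z. hh (fst z, \<psi>' g0)) has_derivative (\<lambda>v. L (fst v, 0))) (at (\<psi> x, \<psi>' g0))"
      by simp
    from has_derivative_diff[OF L this]
    have "(K has_derivative (\<lambda>v. L v - L (fst v, 0))) (at (\<psi> x, \<psi>' g0))"
      by (simp add: K_def[abs_def])
    moreover have "L v - L (fst v, 0) = 0" for v
      using linear_diff[OF has_derivative_linear[OF L], of v "(fst v, 0)"] L0[of "snd v"]
      by (cases v) simp
    ultimately show ?thesis by simp
  qed

  \<comment> \<open>transport from the product chart to a chart of the bundle\<close>
  define \<Phi>h where "\<Phi>h = ?\<chi> \<circ> \<Phi> \<circ> inv_into UP \<phi>"
  define S0 where "S0 = UP \<inter> (\<Phi> -` \<Omega>0 \<inter> \<pi> -` U) \<inter> \<pi> -` N"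
  have c\<pi>: "continuous_on UNIV \<pi>" using smooth_proj by (simp add: smooth_map_def)
  have oU: "open (\<pi> -` U)" "open (\<pi> -` N)" using U(2) \<rho>(2) c\<pi> by (auto intro: open_vimage)
  have "open (\<Phi> -` \<Omega>0 \<inter> \<pi> -` U)"
    using continuous_on_open_vimage[OF oU(1), of \<Phi>] sm o\<Omega>0 by (simp add: smooth_map_def)
  then have S0: "open S0" "S0 \<subseteq> UP" "p \<in> S0"
    using is_chartD(1)[OF cP] oU UP(2) p z0 \<rho>(3) unfolding S0_def
    by (auto simp: x_def[symmetric])
  have "smooth_on \<Phi>h (\<phi> ` (UP \<inter> \<pi> -` U \<inter> \<Phi> -` (V \<times> V')))"
    using sm VV UP(1) unfolding smooth_map_def \<Phi>h_def by fast
  moreover have "\<phi> p \<in> \<phi> ` (UP \<inter> \<pi> -` U \<inter> \<Phi> -` (V \<times> V'))"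
    using UP p V V' by auto
  ultimately have "(\<Phi>h has_derivative frechet_derivative \<Phi>h (at (\<phi> p))) (at (\<phi> p))"
    by (rule smooth_on_has_derivative)
  moreover have "\<Phi>h (\<phi> p) = (\<psi> x, \<psi>' g0)"
    by (simp add: \<Phi>h_def is_chartD(5)[OF cP UP(2)] p)
  ultimately have "((\<lambda>z. K (\<Phi>h z)) has_derivative (\<lambda>v. 0)) (at (\<phi> p))"
    using has_derivative_compose[of \<Phi>h _ "\<phi> p" UNIV K "\<lambda>v. 0"] dK by simp
  then have "((k \<circ> inv_into UP \<phi>) has_derivative (\<lambda>v. 0)) (at (\<phi> p))"
  proof (rule has_derivative_transform_within_open[OF _ chart_open_image[OF cP S0(1,2)]])
    show "\<phi> p \<in> \<phi> ` S0" using S0(3) by blast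
    fix z assume "z \<in> \<phi> ` S0"
    then obtain q where q: "q \<in> S0" "z = \<phi> q" by blast
    obtain g where g: "\<Phi> q = (\<pi> q, g)" using fst[of q] q(1) by (cases "\<Phi> q") (auto simp: S0_def)
    have mem: "\<pi> q \<in> V" "g \<in> V'" "\<pi> q \<in> N" "q \<in> \<pi> -` U"
      using q(1) g \<Omega>0V unfolding S0_def by auto
    have "J (\<pi> q, g) = q" using J\<Phi>[OF mem(4)] g by simp
    then show "K (\<Phi>h z) = (k \<circ> inv_into UP \<phi>) z"
      using S0(2) q mem V'(2)
      by (auto simp: K_def k_def \<Phi>h_def \<mu>_def is_chartD(5)[OF cP] g hh \<rho>(4))
  qed
  from P.tangent_critical[OF D UP k this] have "D k = 0" .
  then show ?thesis
    using P.tangent_diff[OF D h \<mu>\<pi>] vert[OF \<mu>] by (simp add: k_def[abs_def])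
qed

end

theorem lemma5:
  fixes AM :: "('m::{t2_space, second_countable_topology}, 'a::fin_dim_inner) atlas"
    and AP :: "('p::{t2_space, second_countable_topology}, 'c::fin_dim_inner) atlas"
    and AG :: "('g::{t2_space, second_countable_topology}, 'b::fin_dim_inner) atlas"
    and mult :: "'g \<Rightarrow> 'g \<Rightarrow> 'g" and e :: 'g and ginv :: "'g \<Rightarrow> 'g"
    and \<pi> :: "'p \<Rightarrow> 'm" and act :: "'p \<Rightarrow> 'g \<Rightarrow> 'p"
    and \<sigma> :: "'m vfield \<Rightarrow> 'p vfield"
  assumes principal: "principal_bundle AM AP AG mult e ginv \<pi> act"
    and hom: "lie_algebra_hom (compact_vector_fields AM) (invariant_vector_fields AP \<pi> act) \<sigma>"
    and splitting: "\<forall>v\<in>compact_vector_fields AM. pushforward AM \<pi> (\<sigma> v) = v"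
  shows "\<forall>v\<in>compact_vector_fields AM. \<pi> ` vf_supp (\<sigma> v) \<subseteq> vf_supp v"
proof
  interpret principal_bundle AM AP AG mult e ginv \<pi> act by (rule principal)
  have inv: "\<sigma> v \<in> invariant_vector_fields AP \<pi> act" if "v \<in> compact_vector_fields AM" for v
    using hom that by (auto simp: lie_algebra_hom_def)
  then have \<sigma>_vf: "\<sigma> v \<in> vector_fields AP" if "v \<in> compact_vector_fields AM" for v
    using that by (auto simp: invariant_vector_fields_def)
  have lift: "\<sigma> v p (f \<circ> \<pi>) = v (\<pi> p) f"
    if "v \<in> compact_vector_fields AM" "f \<in> smooth_funs AM" for v p f
  proof -
    have "differential AM \<pi> (\<sigma> v p) f = v (\<pi> p) f"
      using pushforward_invariant[OF inv[OF that(1)], of p] splitting that(1) by simp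
    then show ?thesis using that(2) by (simp add: differential_def)
  qed
  have vanish: "\<sigma> v p = (\<lambda>f. 0)"
    if v: "v \<in> compact_vector_fields AM" and p: "\<pi> p \<notin> vf_supp v" for v p
  proof -
    \<comment> \<open>the fields whose support avoids the base point of \<open>p\<close>; \<open>v\<close> is one of them\<close>
    define L where "L = {v \<in> compact_vector_fields AM. vf_supp v \<subseteq> - {\<pi> p}}"
    have LD: "w \<in> compact_vector_fields AM" "w (\<pi> p) = (\<lambda>f. 0)" if "w \<in> L" for w
      using that vf_zero_off_supp[of "\<pi> p" w] by (auto simp: L_def)
    obtain U \<phi> where U: "(U, \<phi>) \<in> AP" "p \<in> U" by (rule P.chart_at)
    note ch = is_chartD[OF P.charts[OF U(1)]]
    obtain \<rho> N C where \<rho>: "\<rho> \<in> smooth_funs AP" "open N" "p \<in> N" "\<And>q. q \<in> N \<Longrightarrow> \<rho> q = 1"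
      and C: "compact C" "C \<subseteq> U" "\<And>q. q \<notin> C \<Longrightarrow> \<rho> q = 0"
      by (rule P.bump[OF ch(1) U(2)]) blast
    define y where "y b q = \<rho> q * (\<phi> q \<bullet> b)" for b q
    have y: "y b \<in> smooth_funs AP" for b
      unfolding y_def
      by (intro P.smooth_fun_cutoff[OF U(1) ch(1) subset_refl compact_imp_closed[OF C(1)] C(2) \<rho>(1) C(3)]
          smooth_on_linear bounded_linear_inner_left ch(2))
    \<comment> \<open>finite codimension: the values on the cut-off coordinates determine a tangent vector at \<open>p\<close>\<close>
    have detect: "\<sigma> w p = (\<lambda>f. 0)" if w: "w \<in> L" and zero: "\<forall>b\<in>onb. \<sigma> w p (y b) = 0" for w
    proof
      fix f
      note D = P.vector_fieldsD(1)[OF \<sigma>_vf[OF LD(1)[OF w]], of p]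
      show "\<sigma> w p f = 0"
      proof (cases "f \<in> smooth_funs AP")
        case True
        from P.tangent_expand[OF D U(1) True \<rho> C] zero show ?thesis
          by (simp add: y_def[abs_def])
      qed (rule P.tangentD(1)[OF D])
    qed
    have T: "\<sigma> w p (y b) = 0" if "w \<in> L" "b \<in> onb" for w b
    proof (rule M.no_finite_codim_ideal[of "- {\<pi> p}" L onb "\<lambda>w b. \<sigma> w p (y b)"])
      show "open (- {\<pi> p})" by (intro open_Compl closed_singleton)
      show "\<sigma> (vf_add v w) p (y b) = \<sigma> v p (y b) + \<sigma> w p (y b)" if "v \<in> L" "w \<in> L" for v w b
        using hom LD(1)[OF that(1)] LD(1)[OF that(2)] by (auto simp: lie_algebra_hom_def vf_add_def)
      show "\<sigma> (vf_scale c v) p (y b) = c * \<sigma> v p (y b)" if "v \<in> L" for c v b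
        using hom LD(1)[OF that] by (auto simp: lie_algebra_hom_def vf_scale_def)
      \<comment> \<open>the kernel is an ideal: \<open>\<sigma>(v)\<close> is zero along the fibre, to which \<open>\<sigma>(w)\<close> is tangent at \<open>p\<close>\<close>
      show "\<sigma> (vf_bracket v w) p (y b) = 0"
        if vw: "v \<in> L" "w \<in> L" and zero: "\<forall>b\<in>onb. \<sigma> v p (y b) = 0" for v w b
      proof -
        have \<sigma>v: "\<sigma> v p = (\<lambda>f. 0)" by (rule detect[OF vw(1) zero])
        have fibre: "\<sigma> v q = (\<lambda>f. 0)" if pq: "\<pi> q = \<pi> p" for q
        proof -
          obtain g where q: "q = act p g" by (rule fibre_transitive[OF pq[symmetric]])
          have "\<sigma> v q = differential AP (\<lambda>q. act q g) (\<sigma> v p)"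
            using inv[OF LD(1)[OF vw(1)]] by (auto simp: invariant_vector_fields_def q)
          then show ?thesis by (simp add: \<sigma>v differential_def fun_eq_iff)
        qed
        have "\<sigma> w p (\<lambda>q. \<sigma> v q (y b)) = 0"
        proof (rule vertical_tangent_to_fibre[of "\<sigma> w p" p])
          show "\<sigma> w p \<in> tangent_space AP p"
            by (rule P.vector_fieldsD(1)[OF \<sigma>_vf[OF LD(1)[OF vw(2)]]])
          show "\<sigma> w p (f \<circ> \<pi>) = 0" if "f \<in> smooth_funs AM" for f
            by (simp add: lift[OF LD(1)[OF vw(2)] that] LD(2)[OF vw(2)])
          show "(\<lambda>q. \<sigma> v q (y b)) \<in> smooth_funs AP"
            by (rule P.vector_fieldsD(2)[OF \<sigma>_vf[OF LD(1)[OF vw(1)]] y])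
          show "\<sigma> v q (y b) = 0" if "\<pi> q = \<pi> p" for q using fibre[OF that] by simp
        qed
        then show ?thesis
          using hom LD(1)[OF vw(1)] LD(1)[OF vw(2)]
          by (auto simp: lie_algebra_hom_def vf_bracket_def \<sigma>v)
      qed
    qed (use that in \<open>simp_all add: L_def\<close>)
    have "v \<in> L" using v p by (auto simp: L_def)
    then show ?thesis using T by (intro detect) auto
  qed
  fix v assume v: "v \<in> compact_vector_fields AM"
  have "{p. \<sigma> v p \<noteq> (\<lambda>f. 0)} \<subseteq> \<pi> -` vf_supp v" using vanish[OF v] by auto
  moreover have "closed (\<pi> -` vf_supp v)"
    using smooth_proj by (intro closed_vimage) (auto simp: smooth_map_def vf_supp_def)
  ultimately have "vf_supp (\<sigma> v) \<subseteq> \<pi> -` vf_supp v"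
    unfolding vf_supp_def[of "\<sigma> v"] by (rule closure_minimal)
  then show "\<pi> ` vf_supp (\<sigma> v) \<subseteq> vf_supp v" by blast
qed

end
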